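(* Let $n\ge1$ and let $\Bbbk$ be a field. The decomposition of $\Bbbk\,\mathcal{PO}_n$ into a direct product of connected algebras is $$\Bbbk\,\mathcal{PO}_n\simeq\Bbbk\times\Bbbk_0\,\mathcal{PO}_n .$$
   Context: $\mathcal{PO}_n$ is the monoid of all order-preserving partial functions on $\{1,\dots,n\}$ ($x\le y\Rightarrow f(x)\le f(y)$ for $x,y$ in the domain of $f$); its zero element is the empty function. $\Bbbk M$ denotes the monoid algebra of a monoid $M$; if $M$ has a zero element $0$, then $\Bbbk_0M=\Bbbk M/\Bbbk\{0\}$, where $\Bbbk\{0\}$ is the ideal spanned by the zero element of $M$. An algebra is connected if $0$ and $1$ are its only central idempotents. *)

theory Defs
  imports "HOL-Algebra.Algebra"
begin

text \<open>The locale \<open>algebra\<close> of HOL-Algebra requires the multiplication to be commutative.\<close>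

locale assoc_algebra = module R A + A?: ring A for R (structure) and A (structure) +
  assumes smult_mult_left:
      "\<lbrakk> c \<in> carrier R; x \<in> carrier A; y \<in> carrier A \<rbrakk> \<Longrightarrow>
        (c \<odot>\<^bsub>A\<^esub> x) \<otimes>\<^bsub>A\<^esub> y = c \<odot>\<^bsub>A\<^esub> (x \<otimes>\<^bsub>A\<^esub> y)"
    and smult_mult_right:
      "\<lbrakk> c \<in> carrier R; x \<in> carrier A; y \<in> carrier A \<rbrakk> \<Longrightarrow>
        x \<otimes>\<^bsub>A\<^esub> (c \<odot>\<^bsub>A\<^esub> y) = c \<odot>\<^bsub>A\<^esub> (x \<otimes>\<^bsub>A\<^esub> y)"

definition central_idempotents :: "('a, 'x) ring_scheme \<Rightarrow> 'a set" where
  "central_idempotents A =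
     {e \<in> carrier A. e \<otimes>\<^bsub>A\<^esub> e = e \<and> (\<forall>x\<in>carrier A. e \<otimes>\<^bsub>A\<^esub> x = x \<otimes>\<^bsub>A\<^esub> e)}"

locale connected_algebra = assoc_algebra +
  assumes connected: "central_idempotents A = {\<zero>\<^bsub>A\<^esub>, \<one>\<^bsub>A\<^esub>}"

definition algebra_iso ::
  "('k, 'x) ring_scheme \<Rightarrow> ('k, 'a, 'y) module_scheme \<Rightarrow> ('k, 'b, 'z) module_scheme \<Rightarrow> ('a \<Rightarrow> 'b) set"
  where
  "algebra_iso K A B =
     {h \<in> ring_iso A B. \<forall>c\<in>carrier K. \<forall>x\<in>carrier A. h (c \<odot>\<^bsub>A\<^esub> x) = c \<odot>\<^bsub>B\<^esub> h x}"

definition isomorphic_algebras ::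
  "('k, 'x) ring_scheme \<Rightarrow> ('k, 'a, 'y) module_scheme \<Rightarrow> ('k, 'b, 'z) module_scheme \<Rightarrow> bool"
  where
  "isomorphic_algebras K A B \<longleftrightarrow> algebra_iso K A B \<noteq> {}"

definition self_algebra :: "('k, 'x) ring_scheme \<Rightarrow> ('k, 'k) module" where
  "self_algebra K =
     \<lparr>carrier = carrier K, monoid.mult = monoid.mult K, one = \<one>\<^bsub>K\<^esub>, ring.zero = \<zero>\<^bsub>K\<^esub>,
      add = ring.add K, smult = monoid.mult K\<rparr>"

definition algebra_prod ::
  "('k, 'a, 'y) module_scheme \<Rightarrow> ('k, 'b, 'z) module_scheme \<Rightarrow> ('k, 'a \<times> 'b) module" where
  "algebra_prod A B =
     ring.extend (RDirProd A B)
       \<lparr>smult = (\<lambda>c p. (c \<odot>\<^bsub>A\<^esub> fst p, c \<odot>\<^bsub>B\<^esub> snd p))\<rparr>"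

text \<open>
  Scalar multiplication on the quotient by a two-sided ideal follows the pattern of
  \<^const>\<open>rcoset_mult\<close>: for a coset \<open>Y\<close> of \<open>I\<close>, all \<open>I +> c \<odot> x\<close> with \<open>x \<in> Y\<close> coincide.
\<close>

definition algebra_quot :: "('k, 'a, 'y) module_scheme \<Rightarrow> 'a set \<Rightarrow> ('k, 'a set) module" where
  "algebra_quot A I =
     ring.extend (A Quot I)
       \<lparr>smult = (\<lambda>c Y. \<Union>x\<in>Y. I +>\<^bsub>A\<^esub> (c \<odot>\<^bsub>A\<^esub> x))\<rparr>"

definition basis_elt :: "('k, 'x) ring_scheme \<Rightarrow> ('m, 'y) monoid_scheme \<Rightarrow> 'm \<Rightarrow> 'm \<Rightarrow> 'k" where
  "basis_elt K M s = (\<lambda>m\<in>carrier M. if m = s then \<one>\<^bsub>K\<^esub> else \<zero>\<^bsub>K\<^esub>)"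

definition supp :: "('k, 'x) ring_scheme \<Rightarrow> ('m, 'y) monoid_scheme \<Rightarrow> ('m \<Rightarrow> 'k) \<Rightarrow> 'm set" where
  "supp K M a = {m \<in> carrier M. a m \<noteq> \<zero>\<^bsub>K\<^esub>}"

text \<open>
  The formal linear combination \<open>\<Sum>m. a m \<cdot> m\<close> is represented by its finitely supported
  coefficient function \<open>a\<close>, which is \<^const>\<open>undefined\<close> outside the carrier of the monoid.
\<close>

definition monoid_algebra ::
  "('k, 'x) ring_scheme \<Rightarrow> ('m, 'y) monoid_scheme \<Rightarrow> ('k, 'm \<Rightarrow> 'k) module" where
  "monoid_algebra K M =
     \<lparr>carrier = {a \<in> carrier M \<rightarrow>\<^sub>E carrier K. finite (supp K M a)},
      monoid.mult = (\<lambda>a b. \<lambda>m\<in>carrier M.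
        \<Oplus>\<^bsub>K\<^esub>p\<in>{p \<in> supp K M a \<times> supp K M b. fst p \<otimes>\<^bsub>M\<^esub> snd p = m}. a (fst p) \<otimes>\<^bsub>K\<^esub> b (snd p)),
      one = basis_elt K M \<one>\<^bsub>M\<^esub>,
      ring.zero = (\<lambda>m\<in>carrier M. \<zero>\<^bsub>K\<^esub>),
      add = (\<lambda>a b. \<lambda>m\<in>carrier M. a m \<oplus>\<^bsub>K\<^esub> b m),
      smult = (\<lambda>c a. \<lambda>m\<in>carrier M. c \<otimes>\<^bsub>K\<^esub> a m)\<rparr>"

definition is_monoid_zero :: "('m, 'y) monoid_scheme \<Rightarrow> 'm \<Rightarrow> bool" where
  "is_monoid_zero M z \<longleftrightarrow>
     z \<in> carrier M \<and> (\<forall>x\<in>carrier M. z \<otimes>\<^bsub>M\<^esub> x = z \<and> x \<otimes>\<^bsub>M\<^esub> z = z)"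

definition monoid_zero :: "('m, 'y) monoid_scheme \<Rightarrow> 'm" where
  "monoid_zero M = (THE z. is_monoid_zero M z)"

lemma monoid_zero_eqI:
  assumes z: "is_monoid_zero M z"
  shows "monoid_zero M = z"
  unfolding monoid_zero_def
proof (rule the_equality)
  show "is_monoid_zero M z" by (fact z)
next
  fix w assume w: "is_monoid_zero M w"
  have "w = w \<otimes>\<^bsub>M\<^esub> z" using z w unfolding is_monoid_zero_def by metis
  also have "\<dots> = z" using z w unfolding is_monoid_zero_def by metis
  finally show "w = z" .
qed

text \<open>Only meaningful for monoids with a zero element.\<close>

definition contracted_monoid_algebra ::
  "('k, 'x) ring_scheme \<Rightarrow> ('m, 'y) monoid_scheme \<Rightarrow> ('k, ('m \<Rightarrow> 'k) set) module" where
  "contracted_monoid_algebra K M =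
     algebra_quot (monoid_algebra K M)
       {c \<odot>\<^bsub>monoid_algebra K M\<^esub> basis_elt K M (monoid_zero M) | c. c \<in> carrier K}"

text \<open>The product \<open>f g\<close> is the composition \<open>f \<circ>\<^sub>m g\<close>, i.e.\ first \<open>g\<close>, then \<open>f\<close>.\<close>

definition PO :: "nat \<Rightarrow> (nat \<rightharpoonup> nat) monoid" where
  "PO n =
     \<lparr>carrier = {f. dom f \<subseteq> {1..n} \<and> ran f \<subseteq> {1..n} \<and>
        (\<forall>x\<in>dom f. \<forall>y\<in>dom f. x \<le> y \<longrightarrow> the (f x) \<le> the (f y))},
      monoid.mult = (\<lambda>f g. f \<circ>\<^sub>m g),
      one = Some |` {1..n}\<rparr>"

lemma PO_memD:
  assumes "f \<in> carrier (PO n)" and "f x = Some u"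
  shows "x \<in> {1..n}" and "u \<in> {1..n}"
    and "f y = Some v \<Longrightarrow> x \<le> y \<Longrightarrow> u \<le> v"
proof -
  have f: "dom f \<subseteq> {1..n}" "ran f \<subseteq> {1..n}"
    "\<forall>x\<in>dom f. \<forall>y\<in>dom f. x \<le> y \<longrightarrow> the (f x) \<le> the (f y)"
    using assms(1) unfolding PO_def by simp_all
  show "x \<in> {1..n}" using f(1) domI[of f, OF assms(2)] by (rule subsetD)
  show "u \<in> {1..n}" using f(2) ranI[of f, OF assms(2)] by (rule subsetD)
  show "u \<le> v" if yv: "f y = Some v" and le: "x \<le> y"
    using f(3)[rule_format, OF domI[of f, OF assms(2)] domI[of f, OF yv] le] assms(2) yv by simp
qed

lemma PO_memI:
  assumes "\<And>x u. f x = Some u \<Longrightarrow> x \<in> {1..n} \<and> u \<in> {1..n}"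
    and "\<And>x y u v. f x = Some u \<Longrightarrow> f y = Some v \<Longrightarrow> x \<le> y \<Longrightarrow> u \<le> v"
  shows "f \<in> carrier (PO n)"
proof -
  have "dom f \<subseteq> {1..n}" using assms(1) by (auto simp del: atLeastAtMost_iff)
  moreover have "ran f \<subseteq> {1..n}" using assms(1) by (auto simp: ran_def simp del: atLeastAtMost_iff)
  moreover have "\<forall>x\<in>dom f. \<forall>y\<in>dom f. x \<le> y \<longrightarrow> the (f x) \<le> the (f y)"
  proof (intro ballI impI)
    fix x y assume "x \<in> dom f" "y \<in> dom f" and le: "x \<le> y"
    then obtain u v where "f x = Some u" "f y = Some v" by blast
    with assms(2)[OF this le] show "the (f x) \<le> the (f y)" by simp
  qed
  ultimately show ?thesis unfolding PO_def by simp
qed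

lemma PO_mult: "f \<otimes>\<^bsub>PO n\<^esub> g = f \<circ>\<^sub>m g"
  and PO_one: "\<one>\<^bsub>PO n\<^esub> = Some |` {1..n}"
  by (simp_all add: PO_def)

lemma monoid_PO: "Group.monoid (PO n)"
proof (rule monoidI)
  fix f g assume f: "f \<in> carrier (PO n)" and g: "g \<in> carrier (PO n)"
  show "f \<otimes>\<^bsub>PO n\<^esub> g \<in> carrier (PO n)"
    unfolding PO_mult
  proof (rule PO_memI)
    fix x u assume "(f \<circ>\<^sub>m g) x = Some u"
    then obtain w where "g x = Some w" "f w = Some u" unfolding map_comp_Some_iff by blast
    then show "x \<in> {1..n} \<and> u \<in> {1..n}" using PO_memD(1)[OF g] PO_memD(2)[OF f] by blast
  next
    fix x y u v assume "(f \<circ>\<^sub>m g) x = Some u" "(f \<circ>\<^sub>m g) y = Some v" and le: "x \<le> y"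
    then obtain w z where w: "g x = Some w" "f w = Some u" and z: "g y = Some z" "f z = Some v"
      unfolding map_comp_Some_iff by blast
    show "u \<le> v" by (rule PO_memD(3)[OF f w(2) z(2) PO_memD(3)[OF g w(1) z(1) le]])
  qed
next
  fix f g h
  show "f \<otimes>\<^bsub>PO n\<^esub> g \<otimes>\<^bsub>PO n\<^esub> h = f \<otimes>\<^bsub>PO n\<^esub> (g \<otimes>\<^bsub>PO n\<^esub> h)"
    unfolding PO_mult by (rule ext) (simp add: map_comp_def split: option.splits)
next
  show "\<one>\<^bsub>PO n\<^esub> \<in> carrier (PO n)"
    unfolding PO_one by (rule PO_memI) (auto simp: restrict_map_def split: if_splits)
next
  fix f assume f: "f \<in> carrier (PO n)"
  show "\<one>\<^bsub>PO n\<^esub> \<otimes>\<^bsub>PO n\<^esub> f = f"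
    unfolding PO_mult PO_one
  proof
    fix x
    show "((Some |` {1..n}) \<circ>\<^sub>m f) x = f x"
      using PO_memD(2)[OF f, of x] by (cases "f x") (simp_all add: map_comp_def restrict_map_def)
  qed
  show "f \<otimes>\<^bsub>PO n\<^esub> \<one>\<^bsub>PO n\<^esub> = f"
    unfolding PO_mult PO_one
  proof
    fix x
    show "(f \<circ>\<^sub>m (Some |` {1..n})) x = f x"
      using PO_memD(1)[OF f, of x] by (cases "f x") (auto simp: map_comp_def restrict_map_def)
  qed
qed

lemma monoid_zero_PO: "monoid_zero (PO n) = Map.empty"
proof (rule monoid_zero_eqI)
  have "Map.empty \<circ>\<^sub>m f = Map.empty" for f :: "nat \<rightharpoonup> nat"
    by (rule ext) (simp add: map_comp_def split: option.split)
  moreover have "Map.empty \<in> carrier (PO n)" by (rule PO_memI) simp_all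
  ultimately show "is_monoid_zero (PO n) Map.empty"
    by (simp add: is_monoid_zero_def PO_mult)
qed

end

theory Submission
  imports Defs
begin

text \<open>
  The empty function \<open>z\<close> satisfies \<open>x z = z x = \<epsilon>(x) z\<close> for the augmentation \<open>\<epsilon>\<close>, so it is a central
  idempotent and \<open>x \<mapsto> (\<epsilon>(x), x + \<langle>z\<rangle>)\<close> is an isomorphism onto the product. A central element of the
  quotient lifts to a central element \<open>x\<close> of the monoid algebra, because a commutator has
  augmentation \<open>0\<close>, hence vanishes if it is a multiple of \<open>z\<close>. To find the center, let
  \<open>hat f\<close> be the sum of the coefficients at all extensions of the partial function \<open>f\<close>. These
  are the coordinates for the Moebius-inverted basis, which identifies the algebra with that of the
  category of order-preserving surjections between subsets of \<open>{1..n}\<close>. The only endomorphisms in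
  that category are identities, so \<open>hat f x = 0\<close> unless \<open>f\<close> is a partial identity. A constant
  map from a nonempty \<open>A\<close> to \<open>{a}\<close> shows that \<open>hat\<close> takes the same value at the identities on \<open>A\<close>
  and \<open>{a}\<close>. So \<open>x\<close> is a combination of \<open>1\<close> and \<open>z\<close>, and the quotient has center \<open>K\<close>.
\<close>

section \<open>Quotients and augmentations of algebras\<close>

text \<open>\<open>self_algebra\<close> and \<open>algebra_quot\<close> are records of another type
  than the rings from which they are built. The ring laws involve five fields only and are carried
  over field by field.\<close>

lemma ring_record_cong:
  assumes "ring R" and "carrier S = carrier R" "monoid.mult S = monoid.mult R"
    "one S = one R" "ring.zero S = ring.zero R" "add S = add R"
  shows "ring S"
proof -
  interpret ring R by fact
  show ?thesis
  proof (rule ringI)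
    show "abelian_group S"
    proof (rule abelian_groupI)
      fix x assume "x \<in> carrier S"
      then show "\<exists>y\<in>carrier S. y \<oplus>\<^bsub>S\<^esub> x = \<zero>\<^bsub>S\<^esub>"
        using assms by (metis a_inv_closed l_neg)
    qed (simp_all add: assms a_ac)
    show "Group.monoid S"
      by (rule monoidI) (simp_all add: assms m_assoc)
  qed (simp_all add: assms l_distr r_distr)
qed

lemma self_algebra_simps [simp]:
  "carrier (self_algebra K) = carrier K" "monoid.mult (self_algebra K) = monoid.mult K"
  "one (self_algebra K) = one K" "ring.zero (self_algebra K) = ring.zero K"
  "add (self_algebra K) = add K" "smult (self_algebra K) = monoid.mult K"
  by (simp_all add: self_algebra_def)

lemma algebra_prod_simps [simp]:
  "carrier (algebra_prod A B) = carrier A \<times> carrier B"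
  "p \<otimes>\<^bsub>algebra_prod A B\<^esub> q = (fst p \<otimes>\<^bsub>A\<^esub> fst q, snd p \<otimes>\<^bsub>B\<^esub> snd q)"
  "\<one>\<^bsub>algebra_prod A B\<^esub> = (\<one>\<^bsub>A\<^esub>, \<one>\<^bsub>B\<^esub>)"
  "p \<oplus>\<^bsub>algebra_prod A B\<^esub> q = (fst p \<oplus>\<^bsub>A\<^esub> fst q, snd p \<oplus>\<^bsub>B\<^esub> snd q)"
  "c \<odot>\<^bsub>algebra_prod A B\<^esub> p = (c \<odot>\<^bsub>A\<^esub> fst p, c \<odot>\<^bsub>B\<^esub> snd p)"
  by (simp_all add: algebra_prod_def ring.defs RDirProd_def DirProd_def monoid.defs case_prod_beta)

lemma (in cring) assoc_algebra_self: "assoc_algebra R (self_algebra R)"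
proof (intro assoc_algebra.intro assoc_algebra_axioms.intro moduleI)
  show "ring (self_algebra R)"
    using ring_axioms by (rule ring_record_cong) simp_all
  then show "abelian_group (self_algebra R)" by (rule ring.is_abelian_group)
qed (auto simp: l_distr r_distr m_assoc m_lcomm is_cring)

lemma (in field) connected_self: "connected_algebra R (self_algebra R)"
proof (rule connected_algebra.intro[OF assoc_algebra_self], rule connected_algebra_axioms.intro)
  \<comment> \<open>A nonzero \<open>e\<close> can be cancelled from e * e = 1 * e.\<close>
  have "e = \<zero> \<or> e = \<one>" if "e \<in> carrier R" "e \<otimes> e = e" for e
    using that by (metis m_rcancel one_closed l_one)
  then show "central_idempotents (self_algebra R) = {\<zero>\<^bsub>self_algebra R\<^esub>, \<one>\<^bsub>self_algebra R\<^esub>}"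
    by (auto simp: central_idempotents_def m_comm)
qed

context assoc_algebra
begin

text \<open>The scalar c acts as multiplication by the ring element c 1, so ideals of the ring are
  automatically submodules.\<close>

lemma ideal_smult_closed:
  assumes "ideal I A" "c \<in> carrier R" "x \<in> I"
  shows "c \<odot>\<^bsub>A\<^esub> x \<in> I"
proof -
  have x: "x \<in> carrier A" using assms ideal.Icarr by fast
  have "c \<odot>\<^bsub>A\<^esub> x = (c \<odot>\<^bsub>A\<^esub> \<one>\<^bsub>A\<^esub>) \<otimes>\<^bsub>A\<^esub> x" using x assms by (simp add: smult_mult_left)
  also have "\<dots> \<in> I" using x assms by (intro ideal.I_l_closed[OF assms(1)]) auto
  finally show ?thesis .
qed

lemma quot_carrier:
  "carrier (algebra_quot A I) = (\<lambda>a. I +>\<^bsub>A\<^esub> a) ` carrier A"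
  by (auto simp: algebra_quot_def ring.defs FactRing_def A_RCOSETS_def')

lemma quot_zero: "\<zero>\<^bsub>algebra_quot A I\<^esub> = I"
  and quot_one: "\<one>\<^bsub>algebra_quot A I\<^esub> = I +>\<^bsub>A\<^esub> \<one>\<^bsub>A\<^esub>"
  by (simp_all add: algebra_quot_def ring.defs FactRing_def)

lemma quot_add:
  "ideal I A \<Longrightarrow> a \<in> carrier A \<Longrightarrow> b \<in> carrier A \<Longrightarrow>
    (I +>\<^bsub>A\<^esub> a) \<oplus>\<^bsub>algebra_quot A I\<^esub> (I +>\<^bsub>A\<^esub> b) = I +>\<^bsub>A\<^esub> (a \<oplus>\<^bsub>A\<^esub> b)"
  by (simp add: algebra_quot_def ring.defs FactRing_def ideal.a_rcos_sum)

lemma quot_mult: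
  "ideal I A \<Longrightarrow> a \<in> carrier A \<Longrightarrow> b \<in> carrier A \<Longrightarrow>
    (I +>\<^bsub>A\<^esub> a) \<otimes>\<^bsub>algebra_quot A I\<^esub> (I +>\<^bsub>A\<^esub> b) = I +>\<^bsub>A\<^esub> (a \<otimes>\<^bsub>A\<^esub> b)"
  by (simp add: algebra_quot_def ring.defs FactRing_def ideal.rcoset_mult_add)

lemma quot_eq_iff:
  assumes "ideal I A" "a \<in> carrier A" "b \<in> carrier A"
  shows "I +>\<^bsub>A\<^esub> a = I +>\<^bsub>A\<^esub> b \<longleftrightarrow> a \<ominus>\<^bsub>A\<^esub> b \<in> I"
  using A.quotient_eq_iff_same_a_r_cos[OF assms] by simp

text \<open>The definition takes a union over all representatives of the coset. Passing from
  \<open>a\<close> to i + a changes the result by the coset of c i, which is trivial because c i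
  lies in the ideal. So the union runs over a nonempty family of equal sets.\<close>

lemma quot_smult:
  assumes I: "ideal I A" and c: "c \<in> carrier R" and a: "a \<in> carrier A"
  shows "c \<odot>\<^bsub>algebra_quot A I\<^esub> (I +>\<^bsub>A\<^esub> a) = I +>\<^bsub>A\<^esub> (c \<odot>\<^bsub>A\<^esub> a)"
proof -
  interpret ideal I A by fact
  have eq: "I +>\<^bsub>A\<^esub> (c \<odot>\<^bsub>A\<^esub> x) = I +>\<^bsub>A\<^esub> (c \<odot>\<^bsub>A\<^esub> a)" if "x \<in> I +>\<^bsub>A\<^esub> a" for x
  proof -
    from that obtain i where i: "i \<in> I" and x: "x = i \<oplus>\<^bsub>A\<^esub> a"
      by (auto simp: a_r_coset_def')
    have "I +>\<^bsub>A\<^esub> (c \<odot>\<^bsub>A\<^esub> x) = (I +>\<^bsub>A\<^esub> (c \<odot>\<^bsub>A\<^esub> i)) <+>\<^bsub>A\<^esub> (I +>\<^bsub>A\<^esub> (c \<odot>\<^bsub>A\<^esub> a))"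
      using i x c a Icarr[OF i] by (simp add: smult_r_distr ideal.a_rcos_sum[OF I])
    also have "I +>\<^bsub>A\<^esub> (c \<odot>\<^bsub>A\<^esub> i) = I +>\<^bsub>A\<^esub> \<zero>\<^bsub>A\<^esub>"
      using ideal_smult_closed[OF I c i] by (simp add: a_rcos_const a_subset)
    also have "\<dots> <+>\<^bsub>A\<^esub> (I +>\<^bsub>A\<^esub> (c \<odot>\<^bsub>A\<^esub> a)) = I +>\<^bsub>A\<^esub> (c \<odot>\<^bsub>A\<^esub> a)"
      using a c by (subst ideal.a_rcos_sum[OF I]) auto
    finally show ?thesis .
  qed
  have "c \<odot>\<^bsub>algebra_quot A I\<^esub> (I +>\<^bsub>A\<^esub> a) = (\<Union>x\<in>I +>\<^bsub>A\<^esub> a. I +>\<^bsub>A\<^esub> (c \<odot>\<^bsub>A\<^esub> a))"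
    using eq by (simp add: algebra_quot_def ring.defs)
  also have "\<dots> = I +>\<^bsub>A\<^esub> (c \<odot>\<^bsub>A\<^esub> a)"
    using a_rcos_self[OF a] by auto
  finally show ?thesis .
qed

lemma assoc_algebra_quot:
  assumes I: "ideal I A"
  shows "assoc_algebra R (algebra_quot A I)"
proof (intro assoc_algebra.intro assoc_algebra_axioms.intro moduleI)
  show "ring (algebra_quot A I)"
    using ideal.quotient_is_ring[OF I]
    by (rule ring_record_cong) (simp_all add: algebra_quot_def ring.defs)
  then show "abelian_group (algebra_quot A I)" by (rule ring.is_abelian_group)
qed (auto simp: quot_carrier quot_smult[OF I] quot_add[OF I] quot_mult[OF I] R.is_cring
    smult_l_distr smult_r_distr smult_assoc1 smult_mult_left smult_mult_right)

end

section \<open>Splitting an algebra along an augmentation\<close>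

text \<open>In the application \<open>\<phi>\<close> is the sum of the coefficients and
  \<open>e\<close> the basis element of the empty function. Taking x = e in \<open>mult_e\<close>
  gives e * e = e, so \<open>e\<close> is a central idempotent.\<close>

locale augmented_algebra = assoc_algebra +
  fixes \<phi> e
  assumes hom: "\<phi> \<in> ring_hom A R"
    and hom_smult: "\<And>c x. c \<in> carrier R \<Longrightarrow> x \<in> carrier A \<Longrightarrow> \<phi> (c \<odot>\<^bsub>A\<^esub> x) = c \<otimes> \<phi> x"
    and e_closed [simp]: "e \<in> carrier A"
    and hom_e: "\<phi> e = \<one>"
    and mult_e: "\<And>x. x \<in> carrier A \<Longrightarrow> x \<otimes>\<^bsub>A\<^esub> e = \<phi> x \<odot>\<^bsub>A\<^esub> e"
    and e_mult: "\<And>x. x \<in> carrier A \<Longrightarrow> e \<otimes>\<^bsub>A\<^esub> x = \<phi> x \<odot>\<^bsub>A\<^esub> e"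
begin

definition line :: "'c set" where
  "line = {c \<odot>\<^bsub>A\<^esub> e | c. c \<in> carrier R}"

lemma hom_closed [simp]: "x \<in> carrier A \<Longrightarrow> \<phi> x \<in> carrier R"
  using hom by (rule ring_hom_closed)

lemma hom_simps:
  "x \<in> carrier A \<Longrightarrow> y \<in> carrier A \<Longrightarrow> \<phi> (x \<oplus>\<^bsub>A\<^esub> y) = \<phi> x \<oplus> \<phi> y"
  "x \<in> carrier A \<Longrightarrow> y \<in> carrier A \<Longrightarrow> \<phi> (x \<otimes>\<^bsub>A\<^esub> y) = \<phi> x \<otimes> \<phi> y"
  "\<phi> \<one>\<^bsub>A\<^esub> = \<one>"
  using hom by (auto simp: ring_hom_add ring_hom_mult ring_hom_one)

lemma hom_minus:
  assumes "x \<in> carrier A" "y \<in> carrier A"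
  shows "\<phi> (x \<ominus>\<^bsub>A\<^esub> y) = \<phi> x \<ominus> \<phi> y"
proof -
  have "ring_hom_ring A R \<phi>"
    using hom by (intro ring_hom_ringI2 A.ring_axioms R.ring_axioms)
  then interpret h: ring_hom_ring A R \<phi> .
  show ?thesis using assms by (simp add: a_minus_def)
qed

lemma line_ideal: "ideal line A"
proof (rule idealI[OF A.ring_axioms])
  show "subgroup line (add_monoid A)"
  proof (rule M.add.subgroupI)
    show "line \<noteq> {}" by (auto simp: line_def)
    fix x assume "x \<in> line"
    then obtain c where c: "c \<in> carrier R" "x = c \<odot>\<^bsub>A\<^esub> e" by (auto simp: line_def)
    then have "\<ominus>\<^bsub>A\<^esub> x = (\<ominus> c) \<odot>\<^bsub>A\<^esub> e" by (simp add: smult_l_minus)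
    then show "\<ominus>\<^bsub>A\<^esub> x \<in> line" using c by (auto simp: line_def)
    fix y assume "y \<in> line"
    then obtain d where d: "d \<in> carrier R" "y = d \<odot>\<^bsub>A\<^esub> e" by (auto simp: line_def)
    have "x \<oplus>\<^bsub>A\<^esub> y = (c \<oplus> d) \<odot>\<^bsub>A\<^esub> e" using c d by (simp add: smult_l_distr)
    then show "x \<oplus>\<^bsub>A\<^esub> y \<in> line" using c d by (auto simp: line_def)
  qed (auto simp: line_def)
next
  fix a x assume "a \<in> line" and x: "x \<in> carrier A"
  then obtain c where c: "c \<in> carrier R" "a = c \<odot>\<^bsub>A\<^esub> e" by (auto simp: line_def)
  have "x \<otimes>\<^bsub>A\<^esub> a = (c \<otimes> \<phi> x) \<odot>\<^bsub>A\<^esub> e" "a \<otimes>\<^bsub>A\<^esub> x = (c \<otimes> \<phi> x) \<odot>\<^bsub>A\<^esub> e"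
    using c x by (simp_all add: smult_mult_left smult_mult_right mult_e e_mult smult_assoc1)
  then show "x \<otimes>\<^bsub>A\<^esub> a \<in> line" "a \<otimes>\<^bsub>A\<^esub> x \<in> line" using c x by (auto simp: line_def)
qed

text \<open>Since \<phi>(c e) = c, the augmentation is injective on the multiples of
  \<open>e\<close>. Both the injectivity of the splitting and the lifting of central elements rest
  on this.\<close>

lemma line_hom_zero:
  assumes "x \<in> line" "\<phi> x = \<zero>"
  shows "x = \<zero>\<^bsub>A\<^esub>"
proof -
  obtain c where c: "c \<in> carrier R" "x = c \<odot>\<^bsub>A\<^esub> e" using assms(1) by (auto simp: line_def)
  then have "c = \<zero>" using assms(2) by (simp add: hom_smult hom_e)
  then show ?thesis using c by (simp add: smult_l_null)
qed

lemma coset_reduce: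
  assumes "a \<in> carrier A" "c \<in> carrier R"
  shows "line +>\<^bsub>A\<^esub> (a \<oplus>\<^bsub>A\<^esub> c \<odot>\<^bsub>A\<^esub> e) = line +>\<^bsub>A\<^esub> a"
proof -
  have "a \<oplus>\<^bsub>A\<^esub> c \<odot>\<^bsub>A\<^esub> e \<ominus>\<^bsub>A\<^esub> a = c \<odot>\<^bsub>A\<^esub> e"
    using assms by (simp add: a_minus_def M.a_comm[of a] M.a_assoc M.r_neg)
  then show ?thesis
    using assms by (subst quot_eq_iff[OF line_ideal]) (auto simp: line_def)
qed

lemma splitting:
  "(\<lambda>a. (\<phi> a, line +>\<^bsub>A\<^esub> a)) \<in> algebra_iso R A (algebra_prod (self_algebra R) (algebra_quot A line))"
proof -
  let ?h = "\<lambda>a. (\<phi> a, line +>\<^bsub>A\<^esub> a)"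
  let ?B = "algebra_prod (self_algebra R) (algebra_quot A line)"
  have "bij_betw ?h (carrier A) (carrier ?B)"
  proof (rule bij_betwI')
    fix x y assume xy: "x \<in> carrier A" "y \<in> carrier A"
    show "?h x = ?h y \<longleftrightarrow> x = y"
    proof
      assume h: "?h x = ?h y"
      then have "x \<ominus>\<^bsub>A\<^esub> y \<in> line" using quot_eq_iff[OF line_ideal] xy by simp
      moreover have "\<phi> (x \<ominus>\<^bsub>A\<^esub> y) = \<zero>" using h xy by (simp add: hom_minus)
      ultimately have "x \<ominus>\<^bsub>A\<^esub> y = \<zero>\<^bsub>A\<^esub>" by (rule line_hom_zero)
      then show "x = y" using xy by simp
    qed simp
  next
    fix x assume "x \<in> carrier A"
    then show "?h x \<in> carrier ?B" by (auto simp: quot_carrier)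
  next
    fix p assume "p \<in> carrier ?B"
    then obtain c a where p: "p = (c, line +>\<^bsub>A\<^esub> a)" "c \<in> carrier R" "a \<in> carrier A"
      by (auto simp: quot_carrier)
    \<comment> \<open>Adding a multiple of \<open>e\<close> keeps the coset of \<open>a\<close> and
      shifts the augmentation by the coefficient, which is chosen to reach \<open>c\<close>.\<close>
    let ?x = "a \<oplus>\<^bsub>A\<^esub> (c \<ominus> \<phi> a) \<odot>\<^bsub>A\<^esub> e"
    have "\<phi> a \<oplus> (c \<ominus> \<phi> a) = c"
      using p by (simp add: a_minus_def R.a_lcomm R.r_neg)
    then have "?h ?x = p"
      using p by (simp add: coset_reduce hom_simps hom_smult hom_e)
    then show "\<exists>x\<in>carrier A. p = ?h x" using p by (intro bexI[of _ ?x]) auto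
  qed
  then have "?h \<in> ring_iso A ?B"
    by (intro ring_iso_memI) (auto simp: hom_simps quot_carrier quot_add[OF line_ideal] quot_mult[OF line_ideal] quot_one)
  then show ?thesis
    by (simp add: algebra_iso_def hom_smult quot_smult[OF line_ideal])
qed

text \<open>The commutator a x - x a lies in \<open>line\<close> because the cosets commute, and
  \<open>\<phi>\<close> kills it because scalars commute.\<close>

lemma central_lift:
  assumes a: "a \<in> carrier A"
    and central: "\<And>x. x \<in> carrier A \<Longrightarrow>
      (line +>\<^bsub>A\<^esub> a) \<otimes>\<^bsub>algebra_quot A line\<^esub> (line +>\<^bsub>A\<^esub> x)
        = (line +>\<^bsub>A\<^esub> x) \<otimes>\<^bsub>algebra_quot A line\<^esub> (line +>\<^bsub>A\<^esub> a)"
    and x: "x \<in> carrier A"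
  shows "a \<otimes>\<^bsub>A\<^esub> x = x \<otimes>\<^bsub>A\<^esub> a"
proof -
  have "a \<otimes>\<^bsub>A\<^esub> x \<ominus>\<^bsub>A\<^esub> x \<otimes>\<^bsub>A\<^esub> a \<in> line"
    using central[OF x] a x by (simp add: quot_mult[OF line_ideal] quot_eq_iff[OF line_ideal])
  moreover have "\<phi> (a \<otimes>\<^bsub>A\<^esub> x \<ominus>\<^bsub>A\<^esub> x \<otimes>\<^bsub>A\<^esub> a) = \<zero>"
    using a x by (simp add: hom_minus hom_simps R.m_comm)
  ultimately have "a \<otimes>\<^bsub>A\<^esub> x \<ominus>\<^bsub>A\<^esub> x \<otimes>\<^bsub>A\<^esub> a = \<zero>\<^bsub>A\<^esub>" by (rule line_hom_zero)
  then show ?thesis using a x by simp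
qed

text \<open>After lifting, every central element of the quotient is a scalar multiple of its one. It
  remains to see that the scalar of an idempotent is itself idempotent, hence 0 or 1 in the
  field.\<close>

lemma connected_quot:
  assumes "field R" and one: "\<one>\<^bsub>A\<^esub> \<notin> line"
    and center: "\<And>a. a \<in> carrier A \<Longrightarrow> (\<And>x. x \<in> carrier A \<Longrightarrow> a \<otimes>\<^bsub>A\<^esub> x = x \<otimes>\<^bsub>A\<^esub> a) \<Longrightarrow>
      \<exists>c\<in>carrier R. \<exists>d\<in>carrier R. a = c \<odot>\<^bsub>A\<^esub> \<one>\<^bsub>A\<^esub> \<oplus>\<^bsub>A\<^esub> d \<odot>\<^bsub>A\<^esub> e"
  shows "connected_algebra R (algebra_quot A line)"
proof (rule connected_algebra.intro[OF assoc_algebra_quot[OF line_ideal]], rule connected_algebra_axioms.intro)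
  interpret F: field R by fact
  interpret Q: ring "algebra_quot A line"
    by (rule assoc_algebra.axioms(2)[OF assoc_algebra_quot[OF line_ideal]])
  show "central_idempotents (algebra_quot A line)
    = {\<zero>\<^bsub>algebra_quot A line\<^esub>, \<one>\<^bsub>algebra_quot A line\<^esub>}"
  proof (rule equalityI; rule subsetI)
    fix Y assume Y: "Y \<in> central_idempotents (algebra_quot A line)"
    then obtain a where a: "a \<in> carrier A" "Y = line +>\<^bsub>A\<^esub> a"
      by (auto simp: central_idempotents_def quot_carrier)
    have "\<exists>c\<in>carrier R. \<exists>d\<in>carrier R. a = c \<odot>\<^bsub>A\<^esub> \<one>\<^bsub>A\<^esub> \<oplus>\<^bsub>A\<^esub> d \<odot>\<^bsub>A\<^esub> e"
      using Y a by (intro center central_lift) (auto simp: central_idempotents_def quot_carrier)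
    \<comment> \<open>The summand d e of the lifted element disappears in the quotient.\<close>
    then obtain c where c: "c \<in> carrier R" "Y = line +>\<^bsub>A\<^esub> (c \<odot>\<^bsub>A\<^esub> \<one>\<^bsub>A\<^esub>)"
      using a(2) by (auto simp: coset_reduce)
    have "Y \<otimes>\<^bsub>algebra_quot A line\<^esub> Y = Y" using Y by (simp add: central_idempotents_def)
    then have "(c \<otimes> c \<ominus> c) \<odot>\<^bsub>A\<^esub> \<one>\<^bsub>A\<^esub> \<in> line"
      using c by (simp add: quot_mult[OF line_ideal] quot_eq_iff[OF line_ideal] smult_mult_left
          smult_assoc1[symmetric] a_minus_def smult_l_minus smult_l_distr)
    \<comment> \<open>Otherwise this scalar is invertible, and scaling by its inverse puts 1 into
      \<open>line\<close>, contrary to \<open>one\<close>.\<close>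
    have cc: "c \<otimes> c \<ominus> c = \<zero>"
    proof (rule ccontr)
      assume "c \<otimes> c \<ominus> c \<noteq> \<zero>"
      then have u: "c \<otimes> c \<ominus> c \<in> Units R" using c by (simp add: F.field_Units)
      have "inv (c \<otimes> c \<ominus> c) \<odot>\<^bsub>A\<^esub> ((c \<otimes> c \<ominus> c) \<odot>\<^bsub>A\<^esub> \<one>\<^bsub>A\<^esub>) = \<one>\<^bsub>A\<^esub>"
        using u c by (simp add: smult_assoc1[symmetric])
      with ideal_smult_closed[OF line_ideal R.Units_inv_closed[OF u]] show False
        using one \<open>(c \<otimes> c \<ominus> c) \<odot>\<^bsub>A\<^esub> \<one>\<^bsub>A\<^esub> \<in> line\<close> by metis
    qed
    then have "c \<otimes> c = c" using c by simp
    then consider "c = \<zero>" | "c = \<one>" using c by (metis F.m_rcancel R.one_closed R.l_one)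
    then show "Y \<in> {\<zero>\<^bsub>algebra_quot A line\<^esub>, \<one>\<^bsub>algebra_quot A line\<^esub>}"
    proof cases
      case 1
      have "line +>\<^bsub>A\<^esub> \<zero>\<^bsub>A\<^esub> = line"
        using line_ideal additive_subgroup.zero_closed[OF ideal.axioms(1)[OF line_ideal]]
        by (rule A.a_rcos_zero)
      then have "Y = line" by (simp only: c(2) 1 smult_l_null A.one_closed)
      then show ?thesis by (simp only: quot_zero insert_iff simp_thms)
    next
      case 2
      then have "Y = line +>\<^bsub>A\<^esub> \<one>\<^bsub>A\<^esub>" by (simp only: c(2) smult_one A.one_closed)
      then show ?thesis by (simp only: quot_one insert_iff simp_thms)
    qed
  next
    fix Y assume "Y \<in> {\<zero>\<^bsub>algebra_quot A line\<^esub>, \<one>\<^bsub>algebra_quot A line\<^esub>}"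
    then show "Y \<in> central_idempotents (algebra_quot A line)"
      unfolding central_idempotents_def using Q.zero_closed Q.one_closed
      by (elim insertE emptyE) simp_all
  qed
qed

end

section \<open>Linear functionals on a monoid algebra\<close>

text \<open>With \<open>f\<close> the product map on pairs, this merges the convolution sums at the
  various products into one sum over pairs.\<close>

lemma (in abelian_monoid) finsum_fibers:
  assumes "finite P" "finite T" "f ` P \<subseteq> T" "g \<in> P \<rightarrow> carrier G"
  shows "(\<Oplus>k\<in>T. \<Oplus>p\<in>{p \<in> P. f p = k}. g p) = (\<Oplus>p\<in>P. g p)"
proof -
  have "(\<Oplus>p\<in>\<Union>((\<lambda>k. {p \<in> P. f p = k}) ` T). g p) = (\<Oplus>k\<in>T. \<Oplus>p\<in>{p \<in> P. f p = k}. g p)"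
    using assms by (intro add.finprod_UN_disjoint) (auto simp: pairwise_def disjnt_iff)
  moreover have "\<Union>((\<lambda>k. {p \<in> P. f p = k}) ` T) = P" using assms(3) by auto
  ultimately show ?thesis by simp
qed

lemma (in abelian_monoid) finsum_Times:
  assumes "finite S" "finite T" "g \<in> S \<times> T \<rightarrow> carrier G"
  shows "(\<Oplus>p\<in>S \<times> T. g p) = (\<Oplus>u\<in>S. \<Oplus>v\<in>T. g (u, v))"
proof -
  have "(\<Oplus>p\<in>S \<times> T. g p) = (\<Oplus>u\<in>S. \<Oplus>p\<in>{p \<in> S \<times> T. fst p = u}. g p)"
    using assms by (intro finsum_fibers[symmetric]) auto
  also have "\<dots> = (\<Oplus>u\<in>S. \<Oplus>v\<in>T. g (u, v))"
  proof (rule add.finprod_cong'[OF refl])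
    fix u assume u: "u \<in> S"
    have "{p \<in> S \<times> T. fst p = u} = Pair u ` T" using u by auto
    then show "(\<Oplus>p\<in>{p \<in> S \<times> T. fst p = u}. g p) = (\<Oplus>v\<in>T. g (u, v))"
      using assms u by (simp add: inj_on_def add.finprod_reindex Pi_iff)
  qed (use assms in \<open>auto intro!: add.finprod_closed\<close>)
  finally show ?thesis .
qed

section \<open>Functionals given by functions on the monoid\<close>

locale monoid_algebra_setting = K?: cring K + M: Group.monoid M
  for K :: "('k, 'x) ring_scheme" (structure) and M :: "('m, 'y) monoid_scheme"
begin

abbreviation \<A> :: "('k, 'm \<Rightarrow> 'k) module" where "\<A> \<equiv> monoid_algebra K M"

text \<open>The value at \<open>a\<close> of the linear functional that sends each basis element
  \<open>m\<close> to \<open>\<phi> m\<close>.\<close>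

definition pairing :: "('m \<Rightarrow> 'k) \<Rightarrow> ('m \<Rightarrow> 'k) \<Rightarrow> 'k" where
  "pairing \<phi> a = (\<Oplus>m\<in>supp K M a. a m \<otimes> \<phi> m)"

lemma mem_iff: "a \<in> carrier \<A> \<longleftrightarrow> a \<in> carrier M \<rightarrow>\<^sub>E carrier K \<and> finite (supp K M a)"
  by (simp add: monoid_algebra_def)

lemma mem_closed: "a \<in> carrier \<A> \<Longrightarrow> m \<in> carrier M \<Longrightarrow> a m \<in> carrier K"
  by (auto simp: mem_iff)

lemma finite_supp: "a \<in> carrier \<A> \<Longrightarrow> finite (supp K M a)"
  by (simp add: mem_iff)

lemma supp_subset: "supp K M a \<subseteq> carrier M"
  by (auto simp: supp_def)

text \<open>Sums attached to elements with different supports become comparable once they run over a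
  common finite set; the additional terms are zero.\<close>

lemma pairing_eq_finsum:
  assumes "a \<in> carrier \<A>" "\<phi> \<in> carrier M \<rightarrow> carrier K"
    and "finite S" "supp K M a \<subseteq> S" "S \<subseteq> carrier M"
  shows "pairing \<phi> a = (\<Oplus>m\<in>S. a m \<otimes> \<phi> m)"
  unfolding pairing_def
proof (rule add.finprod_mono_neutral_cong_left)
  fix m assume "m \<in> S - supp K M a"
  then show "a m \<otimes> \<phi> m = \<zero>" using assms by (auto simp: supp_def Pi_iff subset_iff)
qed (use assms mem_closed[OF assms(1)] in \<open>auto intro!: m_closed simp: Pi_iff subset_iff\<close>)

lemma pairing_closed [simp]:
  "a \<in> carrier \<A> \<Longrightarrow> \<phi> \<in> carrier M \<rightarrow> carrier K \<Longrightarrow> pairing \<phi> a \<in> carrier K"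
  unfolding pairing_def
  by (rule add.finprod_closed) (auto simp: supp_def Pi_iff mem_closed)

lemma pairing_cong:
  assumes "a \<in> carrier \<A>" "\<psi> \<in> carrier M \<rightarrow> carrier K" "\<And>m. m \<in> carrier M \<Longrightarrow> \<phi> m = \<psi> m"
  shows "pairing \<phi> a = pairing \<psi> a"
  unfolding pairing_def using assms supp_subset mem_closed
  by (intro add.finprod_cong') (auto simp: supp_def)

lemma basis_fun: "basis_elt K M s \<in> carrier M \<rightarrow> carrier K"
  by (auto simp: basis_elt_def)

lemma supp_basis: "supp K M (basis_elt K M s) \<subseteq> {s}"
  by (auto simp: supp_def basis_elt_def split: if_splits)

lemma basis_closed [simp]: "basis_elt K M s \<in> carrier \<A>"
  using supp_basis[of s] by (auto simp: mem_iff basis_elt_def intro: finite_subset)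

lemma pairing_basis_left:
  assumes a: "a \<in> carrier \<A>" and s: "s \<in> carrier M"
  shows "pairing (basis_elt K M s) a = a s"
proof -
  \<comment> \<open>\<open>s\<close> may lie outside the support of \<open>a\<close>; inserting it
    guarantees a term at \<open>s\<close>.\<close>
  let ?S = "insert s (supp K M a)"
  have "pairing (basis_elt K M s) a = (\<Oplus>m\<in>?S. a m \<otimes> basis_elt K M s m)"
    using a s supp_subset finite_supp[OF a] basis_fun by (intro pairing_eq_finsum) auto
  also have "\<dots> = (\<Oplus>m\<in>?S. if s = m then a m else \<zero>)"
    using a s supp_subset mem_closed[OF a]
    by (intro add.finprod_cong') (auto simp: basis_elt_def supp_def)
  also have "\<dots> = a s"
    using a s supp_subset mem_closed[OF a] finite_supp[OF a]
    by (intro add.finprod_singleton) (auto simp: supp_def)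
  finally show ?thesis .
qed

lemma pairing_basis [simp]:
  assumes "\<phi> \<in> carrier M \<rightarrow> carrier K" and s: "s \<in> carrier M"
  shows "pairing \<phi> (basis_elt K M s) = \<phi> s"
proof -
  have "pairing \<phi> (basis_elt K M s) = (\<Oplus>m\<in>{s}. basis_elt K M s m \<otimes> \<phi> m)"
    using assms supp_basis by (intro pairing_eq_finsum) auto
  also have "\<dots> = \<phi> s" using assms by (auto simp: basis_elt_def Pi_iff)
  finally show ?thesis .
qed

text \<open>The functionals dual to the basis read off the coefficients, and outside the carrier
  both functions are \<open>undefined\<close>. The algebra laws below are proved through this
  principle, without handling convolution sums.\<close>

lemma pairing_ext:
  assumes "a \<in> carrier \<A>" "b \<in> carrier \<A>"
    and "\<And>\<phi>. \<phi> \<in> carrier M \<rightarrow> carrier K \<Longrightarrow> pairing \<phi> a = pairing \<phi> b"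
  shows "a = b"
proof (rule PiE_ext)
  show "a \<in> carrier M \<rightarrow>\<^sub>E carrier K" "b \<in> carrier M \<rightarrow>\<^sub>E carrier K"
    using assms(1,2) by (simp_all add: mem_iff)
  fix m assume "m \<in> carrier M"
  then show "a m = b m"
    using assms(3)[OF basis_fun] pairing_basis_left assms(1,2) by metis
qed

section \<open>The operations of the monoid algebra under functionals\<close>

lemma add_closed:
  assumes "a \<in> carrier \<A>" "b \<in> carrier \<A>"
  shows "a \<oplus>\<^bsub>\<A>\<^esub> b \<in> carrier \<A>"
proof -
  have "supp K M (a \<oplus>\<^bsub>\<A>\<^esub> b) \<subseteq> supp K M a \<union> supp K M b"
    using assms by (auto simp: supp_def monoid_algebra_def)
  then show ?thesis
    using assms finite_subset by (fastforce simp: monoid_algebra_def)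
qed

lemma smult_closed:
  assumes "c \<in> carrier K" "a \<in> carrier \<A>"
  shows "c \<odot>\<^bsub>\<A>\<^esub> a \<in> carrier \<A>"
proof -
  have "supp K M (c \<odot>\<^bsub>\<A>\<^esub> a) \<subseteq> supp K M a"
    using assms by (auto simp: supp_def monoid_algebra_def)
  then show ?thesis
    using assms finite_subset by (fastforce simp: monoid_algebra_def)
qed

lemma zero_closed: "\<zero>\<^bsub>\<A>\<^esub> \<in> carrier \<A>"
proof -
  have "supp K M \<zero>\<^bsub>\<A>\<^esub> = {}" by (auto simp: supp_def monoid_algebra_def)
  then show ?thesis by (simp add: mem_iff) (simp add: monoid_algebra_def)
qed

lemma mult_apply:
  assumes "m \<in> carrier M"
  shows "(a \<otimes>\<^bsub>\<A>\<^esub> b) m =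
    (\<Oplus>p\<in>{p \<in> supp K M a \<times> supp K M b. fst p \<otimes>\<^bsub>M\<^esub> snd p = m}. a (fst p) \<otimes> b (snd p))"
  using assms by (simp add: monoid_algebra_def)

lemma supp_mult:
  "supp K M (a \<otimes>\<^bsub>\<A>\<^esub> b) \<subseteq> (\<lambda>p. fst p \<otimes>\<^bsub>M\<^esub> snd p) ` (supp K M a \<times> supp K M b)"
proof
  fix m assume m: "m \<in> supp K M (a \<otimes>\<^bsub>\<A>\<^esub> b)"
  then have "m \<in> carrier M" "(a \<otimes>\<^bsub>\<A>\<^esub> b) m \<noteq> \<zero>" by (simp_all add: supp_def)
  then have "{p \<in> supp K M a \<times> supp K M b. fst p \<otimes>\<^bsub>M\<^esub> snd p = m} \<noteq> {}"
    using mult_apply[of m a b] by (metis (lifting) add.finprod_empty)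
  then show "m \<in> (\<lambda>p. fst p \<otimes>\<^bsub>M\<^esub> snd p) ` (supp K M a \<times> supp K M b)" by blast
qed

lemma mult_closed:
  assumes "a \<in> carrier \<A>" "b \<in> carrier \<A>"
  shows "a \<otimes>\<^bsub>\<A>\<^esub> b \<in> carrier \<A>"
proof -
  have "(a \<otimes>\<^bsub>\<A>\<^esub> b) m \<in> carrier K" if "m \<in> carrier M" for m
    unfolding mult_apply[OF that] using mem_closed assms supp_subset
    by (intro add.finprod_closed) (auto simp: supp_def)
  moreover have "finite (supp K M (a \<otimes>\<^bsub>\<A>\<^esub> b))"
    using assms by (intro finite_subset[OF supp_mult]) (simp add: finite_supp)
  moreover have "(a \<otimes>\<^bsub>\<A>\<^esub> b) m = undefined" if "m \<notin> carrier M" for m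
    using that by (simp add: monoid_algebra_def)
  ultimately show ?thesis by (auto simp: mem_iff)
qed

lemma pairing_zero [simp]: "\<phi> \<in> carrier M \<rightarrow> carrier K \<Longrightarrow> pairing \<phi> \<zero>\<^bsub>\<A>\<^esub> = \<zero>"
  by (simp add: pairing_def supp_def monoid_algebra_def)

lemma pairing_add [simp]:
  assumes a: "a \<in> carrier \<A>" and b: "b \<in> carrier \<A>" and \<phi>: "\<phi> \<in> carrier M \<rightarrow> carrier K"
  shows "pairing \<phi> (a \<oplus>\<^bsub>\<A>\<^esub> b) = pairing \<phi> a \<oplus> pairing \<phi> b"
proof -
  let ?S = "supp K M a \<union> supp K M b"
  have S: "finite ?S" "?S \<subseteq> carrier M" "supp K M (a \<oplus>\<^bsub>\<A>\<^esub> b) \<subseteq> ?S"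
    using a b by (auto simp: supp_def mem_iff) (auto simp: supp_def monoid_algebra_def)
  have "pairing \<phi> (a \<oplus>\<^bsub>\<A>\<^esub> b) = (\<Oplus>m\<in>?S. (a \<oplus>\<^bsub>\<A>\<^esub> b) m \<otimes> \<phi> m)"
    by (rule pairing_eq_finsum[OF add_closed[OF a b] \<phi> S(1,3,2)])
  also have "\<dots> = (\<Oplus>m\<in>?S. a m \<otimes> \<phi> m \<oplus> b m \<otimes> \<phi> m)"
    using \<phi> mem_closed[OF a] mem_closed[OF b]
    by (intro add.finprod_cong') (auto simp: monoid_algebra_def supp_def Pi_iff l_distr)
  also have "\<dots> = (\<Oplus>m\<in>?S. a m \<otimes> \<phi> m) \<oplus> (\<Oplus>m\<in>?S. b m \<otimes> \<phi> m)"
    using \<phi> mem_closed[OF a] mem_closed[OF b]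
    by (intro add.finprod_multf) (auto simp: supp_def Pi_iff)
  also have "\<dots> = pairing \<phi> a \<oplus> pairing \<phi> b"
    using pairing_eq_finsum[OF a \<phi> S(1) _ S(2)] pairing_eq_finsum[OF b \<phi> S(1) _ S(2)] by simp
  finally show ?thesis .
qed

lemma pairing_smult [simp]:
  assumes c: "c \<in> carrier K" and a: "a \<in> carrier \<A>" and \<phi>: "\<phi> \<in> carrier M \<rightarrow> carrier K"
  shows "pairing \<phi> (c \<odot>\<^bsub>\<A>\<^esub> a) = c \<otimes> pairing \<phi> a"
proof -
  let ?S = "supp K M a"
  have S: "finite ?S" "?S \<subseteq> carrier M" "supp K M (c \<odot>\<^bsub>\<A>\<^esub> a) \<subseteq> ?S"
    using a c by (auto simp: supp_def mem_iff) (auto simp: supp_def monoid_algebra_def)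
  have "pairing \<phi> (c \<odot>\<^bsub>\<A>\<^esub> a) = (\<Oplus>m\<in>?S. (c \<odot>\<^bsub>\<A>\<^esub> a) m \<otimes> \<phi> m)"
    by (rule pairing_eq_finsum[OF smult_closed[OF c a] \<phi> S(1,3,2)])
  also have "\<dots> = (\<Oplus>m\<in>?S. c \<otimes> (a m \<otimes> \<phi> m))"
    using \<phi> c mem_closed[OF a]
    by (intro add.finprod_cong') (auto simp: monoid_algebra_def supp_def Pi_iff m_assoc)
  also have "\<dots> = c \<otimes> pairing \<phi> a"
    unfolding pairing_def using \<phi> c mem_closed[OF a] S(1)
    by (intro finsum_rdistr[symmetric]) (auto simp: supp_def Pi_iff)
  finally show ?thesis .
qed

text \<open>In \<open>pairing_mult\<close> the right factor enters through a functional applied to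
  the left factor. Laws about sums and scalars in the right factor therefore need linearity in the
  functional as well.\<close>

lemma pairing_fun_add:
  assumes a: "a \<in> carrier \<A>" and "\<phi> \<in> carrier M \<rightarrow> carrier K" "\<psi> \<in> carrier M \<rightarrow> carrier K"
  shows "pairing (\<lambda>m. \<phi> m \<oplus> \<psi> m) a = pairing \<phi> a \<oplus> pairing \<psi> a"
proof -
  have "pairing (\<lambda>m. \<phi> m \<oplus> \<psi> m) a = (\<Oplus>m\<in>supp K M a. a m \<otimes> \<phi> m \<oplus> a m \<otimes> \<psi> m)"
    unfolding pairing_def using assms mem_closed[OF a]
    by (intro add.finprod_cong') (auto simp: supp_def Pi_iff r_distr)
  also have "\<dots> = pairing \<phi> a \<oplus> pairing \<psi> a"
    unfolding pairing_def using assms mem_closed[OF a]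
    by (intro add.finprod_multf) (auto simp: supp_def Pi_iff)
  finally show ?thesis .
qed

lemma pairing_fun_smult:
  assumes a: "a \<in> carrier \<A>" and "\<phi> \<in> carrier M \<rightarrow> carrier K" "c \<in> carrier K"
  shows "pairing (\<lambda>m. c \<otimes> \<phi> m) a = c \<otimes> pairing \<phi> a"
proof -
  have "pairing (\<lambda>m. c \<otimes> \<phi> m) a = (\<Oplus>m\<in>supp K M a. c \<otimes> (a m \<otimes> \<phi> m))"
    unfolding pairing_def using assms mem_closed[OF a]
    by (intro add.finprod_cong') (auto simp: supp_def Pi_iff m_lcomm)
  also have "\<dots> = c \<otimes> pairing \<phi> a"
    unfolding pairing_def using assms mem_closed[OF a]
    by (intro finsum_rdistr[symmetric]) (auto simp: supp_def Pi_iff mem_iff)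
  finally show ?thesis .
qed

lemma pairing_translate_closed [simp]:
  assumes "b \<in> carrier \<A>" "\<phi> \<in> carrier M \<rightarrow> carrier K"
  shows "(\<lambda>u. pairing (\<lambda>v. \<phi> (u \<otimes>\<^bsub>M\<^esub> v)) b) \<in> carrier M \<rightarrow> carrier K"
  using assms by (auto simp: Pi_iff)

text \<open>A product evaluates to an iterated pairing because grouping all pairs (u, v) by the
  value of u v gives back the convolution. From here on the convolution formula is no longer
  needed.\<close>

lemma pairing_mult:
  assumes a: "a \<in> carrier \<A>" and b: "b \<in> carrier \<A>" and \<phi>: "\<phi> \<in> carrier M \<rightarrow> carrier K"
  shows "pairing \<phi> (a \<otimes>\<^bsub>\<A>\<^esub> b) = pairing (\<lambda>u. pairing (\<lambda>v. \<phi> (u \<otimes>\<^bsub>M\<^esub> v)) b) a"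
proof -
  let ?P = "supp K M a \<times> supp K M b"
  let ?\<mu> = "\<lambda>p. fst p \<otimes>\<^bsub>M\<^esub> snd p"
  let ?F = "\<lambda>k. {p \<in> ?P. ?\<mu> p = k}"
  let ?g = "\<lambda>p. a (fst p) \<otimes> b (snd p) \<otimes> \<phi> (?\<mu> p)"
  have P: "finite ?P" using a b by (simp add: finite_supp)
  have carr: "u \<in> carrier M" "a u \<in> carrier K" if "u \<in> supp K M a" for u
    using that mem_closed[OF a] by (auto simp: supp_def)
  have carr': "u \<in> carrier M" "b u \<in> carrier K" if "u \<in> supp K M b" for u
    using that mem_closed[OF b] by (auto simp: supp_def)
  have g: "?g \<in> ?P \<rightarrow> carrier K" using carr carr' \<phi> by (auto simp: Pi_iff)
  \<comment> \<open>The set of all products of support elements contains the support of the product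
    and is the image to which \<open>finsum_fibers\<close> applies.\<close>
  have "pairing \<phi> (a \<otimes>\<^bsub>\<A>\<^esub> b) = (\<Oplus>k\<in>?\<mu> ` ?P. (a \<otimes>\<^bsub>\<A>\<^esub> b) k \<otimes> \<phi> k)"
    using P carr carr' by (intro pairing_eq_finsum mult_closed a b \<phi> supp_mult) auto
  also have "\<dots> = (\<Oplus>k\<in>?\<mu> ` ?P. \<Oplus>p\<in>?F k. ?g p)"
  proof (rule add.finprod_cong'[OF refl])
    show "(\<lambda>k. \<Oplus>p\<in>?F k. ?g p) \<in> ?\<mu> ` ?P \<rightarrow> carrier K"
      using g by (intro Pi_I add.finprod_closed) auto
    fix k assume "k \<in> ?\<mu> ` ?P"
    then have k: "k \<in> carrier M" using carr carr' by auto
    have "(a \<otimes>\<^bsub>\<A>\<^esub> b) k \<otimes> \<phi> k = (\<Oplus>p\<in>?F k. a (fst p) \<otimes> b (snd p) \<otimes> \<phi> k)"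
      unfolding mult_apply[OF k] using P k \<phi> carr carr'
      by (intro finsum_ldistr) (auto simp: Pi_iff)
    also have "\<dots> = (\<Oplus>p\<in>?F k. ?g p)"
      using g by (intro add.finprod_cong') (auto simp: Pi_iff)
    finally show "(a \<otimes>\<^bsub>\<A>\<^esub> b) k \<otimes> \<phi> k = (\<Oplus>p\<in>?F k. ?g p)" .
  qed
  also have "\<dots> = (\<Oplus>p\<in>?P. ?g p)"
    using P g by (intro finsum_fibers) auto
  also have "\<dots> = (\<Oplus>u\<in>supp K M a. \<Oplus>v\<in>supp K M b. ?g (u, v))"
    using a b g by (intro finsum_Times finite_supp)
  also have "\<dots> = pairing (\<lambda>u. pairing (\<lambda>v. \<phi> (u \<otimes>\<^bsub>M\<^esub> v)) b) a"
    unfolding pairing_def[of _ a]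
  proof (rule add.finprod_cong'[OF refl])
    show "(\<lambda>u. a u \<otimes> pairing (\<lambda>v. \<phi> (u \<otimes>\<^bsub>M\<^esub> v)) b) \<in> supp K M a \<rightarrow> carrier K"
      using carr b \<phi> by (auto simp: Pi_iff)
    fix u assume u: "u \<in> supp K M a"
    have "(\<Oplus>v\<in>supp K M b. ?g (u, v)) = (\<Oplus>v\<in>supp K M b. a u \<otimes> (b v \<otimes> \<phi> (u \<otimes>\<^bsub>M\<^esub> v)))"
      using carr[OF u] carr' \<phi> by (intro add.finprod_cong') (auto simp: Pi_iff m_assoc)
    also have "\<dots> = a u \<otimes> pairing (\<lambda>v. \<phi> (u \<otimes>\<^bsub>M\<^esub> v)) b"
      unfolding pairing_def using carr[OF u] carr' \<phi> finite_supp[OF b]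
      by (intro finsum_rdistr[symmetric]) (auto simp: Pi_iff)
    finally show "(\<Oplus>v\<in>supp K M b. ?g (u, v)) = a u \<otimes> pairing (\<lambda>v. \<phi> (u \<otimes>\<^bsub>M\<^esub> v)) b" .
  qed
  finally show ?thesis .
qed

lemma one_eq: "\<one>\<^bsub>\<A>\<^esub> = basis_elt K M \<one>\<^bsub>M\<^esub>"
  by (simp add: monoid_algebra_def)

lemma one_closed: "\<one>\<^bsub>\<A>\<^esub> \<in> carrier \<A>"
  by (simp add: one_eq)

lemma pairing_mult_basis_right:
  assumes "a \<in> carrier \<A>" "s \<in> carrier M" "\<phi> \<in> carrier M \<rightarrow> carrier K"
  shows "pairing \<phi> (a \<otimes>\<^bsub>\<A>\<^esub> basis_elt K M s) = pairing (\<lambda>u. \<phi> (u \<otimes>\<^bsub>M\<^esub> s)) a"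
  using assms by (simp add: pairing_mult) (rule pairing_cong; auto simp: Pi_iff)

lemma pairing_mult_basis_left:
  assumes "a \<in> carrier \<A>" "s \<in> carrier M" "\<phi> \<in> carrier M \<rightarrow> carrier K"
  shows "pairing \<phi> (basis_elt K M s \<otimes>\<^bsub>\<A>\<^esub> a) = pairing (\<lambda>v. \<phi> (s \<otimes>\<^bsub>M\<^esub> v)) a"
  using assms by (simp add: pairing_mult)

section \<open>The algebra laws\<close>

lemma mult_assoc:
  assumes "a \<in> carrier \<A>" "b \<in> carrier \<A>" "c \<in> carrier \<A>"
  shows "a \<otimes>\<^bsub>\<A>\<^esub> b \<otimes>\<^bsub>\<A>\<^esub> c = a \<otimes>\<^bsub>\<A>\<^esub> (b \<otimes>\<^bsub>\<A>\<^esub> c)"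
proof (rule pairing_ext)
  fix \<phi> assume \<phi>: "\<phi> \<in> carrier M \<rightarrow> carrier K"
  have tr: "(\<lambda>v. \<phi> (u \<otimes>\<^bsub>M\<^esub> v)) \<in> carrier M \<rightarrow> carrier K" if "u \<in> carrier M" for u
    using that \<phi> by (auto simp: Pi_iff)
  have "pairing \<phi> (a \<otimes>\<^bsub>\<A>\<^esub> b \<otimes>\<^bsub>\<A>\<^esub> c)
      = pairing (\<lambda>u. pairing (\<lambda>v. pairing (\<lambda>w. \<phi> (u \<otimes>\<^bsub>M\<^esub> v \<otimes>\<^bsub>M\<^esub> w)) c) b) a"
    using assms \<phi> by (simp add: pairing_mult mult_closed)
  also have "\<dots> = pairing (\<lambda>u. pairing (\<lambda>v. \<phi> (u \<otimes>\<^bsub>M\<^esub> v)) (b \<otimes>\<^bsub>\<A>\<^esub> c)) a"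
  proof (rule pairing_cong)
    fix u assume u: "u \<in> carrier M"
    have "pairing (\<lambda>v. \<phi> (u \<otimes>\<^bsub>M\<^esub> v)) (b \<otimes>\<^bsub>\<A>\<^esub> c)
        = pairing (\<lambda>v. pairing (\<lambda>w. \<phi> (u \<otimes>\<^bsub>M\<^esub> (v \<otimes>\<^bsub>M\<^esub> w))) c) b"
      using assms tr[OF u] by (simp add: pairing_mult)
    also have "\<dots> = pairing (\<lambda>v. pairing (\<lambda>w. \<phi> (u \<otimes>\<^bsub>M\<^esub> v \<otimes>\<^bsub>M\<^esub> w)) c) b"
      using assms u \<phi> by (intro pairing_cong) (auto simp: Pi_iff M.m_assoc intro!: pairing_cong)
    finally show "pairing (\<lambda>v. pairing (\<lambda>w. \<phi> (u \<otimes>\<^bsub>M\<^esub> v \<otimes>\<^bsub>M\<^esub> w)) c) b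
        = pairing (\<lambda>v. \<phi> (u \<otimes>\<^bsub>M\<^esub> v)) (b \<otimes>\<^bsub>\<A>\<^esub> c)" ..
  qed (use assms \<phi> in \<open>simp_all add: mult_closed\<close>)
  also have "\<dots> = pairing \<phi> (a \<otimes>\<^bsub>\<A>\<^esub> (b \<otimes>\<^bsub>\<A>\<^esub> c))"
    using assms \<phi> by (simp add: pairing_mult mult_closed)
  finally show "pairing \<phi> (a \<otimes>\<^bsub>\<A>\<^esub> b \<otimes>\<^bsub>\<A>\<^esub> c) = pairing \<phi> (a \<otimes>\<^bsub>\<A>\<^esub> (b \<otimes>\<^bsub>\<A>\<^esub> c))" .
qed (use assms in \<open>simp_all add: mult_closed\<close>)

lemma add_mult_right:
  assumes "a \<in> carrier \<A>" "b \<in> carrier \<A>" "c \<in> carrier \<A>"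
  shows "c \<otimes>\<^bsub>\<A>\<^esub> (a \<oplus>\<^bsub>\<A>\<^esub> b) = c \<otimes>\<^bsub>\<A>\<^esub> a \<oplus>\<^bsub>\<A>\<^esub> c \<otimes>\<^bsub>\<A>\<^esub> b"
proof (rule pairing_ext)
  fix \<phi> assume \<phi>: "\<phi> \<in> carrier M \<rightarrow> carrier K"
  have tr: "(\<lambda>v. \<phi> (u \<otimes>\<^bsub>M\<^esub> v)) \<in> carrier M \<rightarrow> carrier K" if "u \<in> carrier M" for u
    using that \<phi> by (auto simp: Pi_iff)
  have "pairing \<phi> (c \<otimes>\<^bsub>\<A>\<^esub> (a \<oplus>\<^bsub>\<A>\<^esub> b)) = pairing
      (\<lambda>u. pairing (\<lambda>v. \<phi> (u \<otimes>\<^bsub>M\<^esub> v)) a \<oplus> pairing (\<lambda>v. \<phi> (u \<otimes>\<^bsub>M\<^esub> v)) b) c"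
    using assms \<phi> tr
    by (simp add: pairing_mult add_closed) (intro pairing_cong; simp add: Pi_iff)
  then show "pairing \<phi> (c \<otimes>\<^bsub>\<A>\<^esub> (a \<oplus>\<^bsub>\<A>\<^esub> b)) = pairing \<phi> (c \<otimes>\<^bsub>\<A>\<^esub> a \<oplus>\<^bsub>\<A>\<^esub> c \<otimes>\<^bsub>\<A>\<^esub> b)"
    using assms \<phi> by (simp add: pairing_mult mult_closed pairing_fun_add)
qed (use assms in \<open>simp_all add: mult_closed add_closed\<close>)

lemma mult_smult:
  assumes "a \<in> carrier \<A>" "b \<in> carrier \<A>" "c \<in> carrier K"
  shows "a \<otimes>\<^bsub>\<A>\<^esub> (c \<odot>\<^bsub>\<A>\<^esub> b) = c \<odot>\<^bsub>\<A>\<^esub> (a \<otimes>\<^bsub>\<A>\<^esub> b)"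
proof (rule pairing_ext)
  fix \<phi> assume \<phi>: "\<phi> \<in> carrier M \<rightarrow> carrier K"
  have tr: "(\<lambda>v. \<phi> (u \<otimes>\<^bsub>M\<^esub> v)) \<in> carrier M \<rightarrow> carrier K" if "u \<in> carrier M" for u
    using that \<phi> by (auto simp: Pi_iff)
  have "pairing \<phi> (a \<otimes>\<^bsub>\<A>\<^esub> (c \<odot>\<^bsub>\<A>\<^esub> b))
      = pairing (\<lambda>u. c \<otimes> pairing (\<lambda>v. \<phi> (u \<otimes>\<^bsub>M\<^esub> v)) b) a"
    using assms \<phi> tr
    by (simp add: pairing_mult smult_closed) (intro pairing_cong; simp add: Pi_iff)
  then show "pairing \<phi> (a \<otimes>\<^bsub>\<A>\<^esub> (c \<odot>\<^bsub>\<A>\<^esub> b)) = pairing \<phi> (c \<odot>\<^bsub>\<A>\<^esub> (a \<otimes>\<^bsub>\<A>\<^esub> b))"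
    using assms \<phi> by (simp add: pairing_mult mult_closed pairing_fun_smult)
qed (use assms in \<open>simp_all add: mult_closed smult_closed\<close>)

lemma abelian_group: "abelian_group \<A>"
proof (rule abelian_groupI)
  fix x y z assume "x \<in> carrier \<A>" "y \<in> carrier \<A>" "z \<in> carrier \<A>"
  then show "x \<oplus>\<^bsub>\<A>\<^esub> y \<oplus>\<^bsub>\<A>\<^esub> z = x \<oplus>\<^bsub>\<A>\<^esub> (y \<oplus>\<^bsub>\<A>\<^esub> z)"
    by (intro pairing_ext) (simp_all add: add_closed a_assoc)
next
  fix x y assume "x \<in> carrier \<A>" "y \<in> carrier \<A>"
  then show "x \<oplus>\<^bsub>\<A>\<^esub> y = y \<oplus>\<^bsub>\<A>\<^esub> x"
    by (intro pairing_ext) (simp_all add: add_closed a_comm)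
next
  fix x assume x: "x \<in> carrier \<A>"
  then show "\<zero>\<^bsub>\<A>\<^esub> \<oplus>\<^bsub>\<A>\<^esub> x = x"
    by (intro pairing_ext) (simp_all add: add_closed zero_closed)
  have "(\<ominus> \<one>) \<odot>\<^bsub>\<A>\<^esub> x \<oplus>\<^bsub>\<A>\<^esub> x = \<zero>\<^bsub>\<A>\<^esub>"
    using x by (intro pairing_ext) (simp_all add: add_closed zero_closed smult_closed l_minus l_neg)
  then show "\<exists>y\<in>carrier \<A>. y \<oplus>\<^bsub>\<A>\<^esub> x = \<zero>\<^bsub>\<A>\<^esub>"
    using x by (meson K.one_closed a_inv_closed smult_closed)
qed (simp_all add: add_closed zero_closed)

lemma one_mult:
  assumes "a \<in> carrier \<A>"
  shows "\<one>\<^bsub>\<A>\<^esub> \<otimes>\<^bsub>\<A>\<^esub> a = a" and "a \<otimes>\<^bsub>\<A>\<^esub> \<one>\<^bsub>\<A>\<^esub> = a"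
proof -
  show "\<one>\<^bsub>\<A>\<^esub> \<otimes>\<^bsub>\<A>\<^esub> a = a"
  proof (rule pairing_ext)
    fix \<phi> assume \<phi>: "\<phi> \<in> carrier M \<rightarrow> carrier K"
    have "pairing (\<lambda>v. \<phi> (\<one>\<^bsub>M\<^esub> \<otimes>\<^bsub>M\<^esub> v)) a = pairing \<phi> a"
      using assms \<phi> by (rule pairing_cong) simp
    then show "pairing \<phi> (\<one>\<^bsub>\<A>\<^esub> \<otimes>\<^bsub>\<A>\<^esub> a) = pairing \<phi> a"
      using assms \<phi> by (simp add: one_eq pairing_mult_basis_left)
  qed (use assms in \<open>simp_all add: mult_closed one_closed\<close>)
  show "a \<otimes>\<^bsub>\<A>\<^esub> \<one>\<^bsub>\<A>\<^esub> = a"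
  proof (rule pairing_ext)
    fix \<phi> assume \<phi>: "\<phi> \<in> carrier M \<rightarrow> carrier K"
    have "pairing (\<lambda>v. \<phi> (v \<otimes>\<^bsub>M\<^esub> \<one>\<^bsub>M\<^esub>)) a = pairing \<phi> a"
      using assms \<phi> by (rule pairing_cong) simp
    then show "pairing \<phi> (a \<otimes>\<^bsub>\<A>\<^esub> \<one>\<^bsub>\<A>\<^esub>) = pairing \<phi> a"
      using assms \<phi> by (simp add: one_eq pairing_mult_basis_right)
  qed (use assms in \<open>simp_all add: mult_closed one_closed\<close>)
qed

lemma ring: "ring \<A>"
proof (rule ringI[OF abelian_group])
  show "Group.monoid \<A>"
    by (rule monoidI) (simp_all add: mult_closed one_closed mult_assoc one_mult)
  fix x y z assume x: "x \<in> carrier \<A>" "y \<in> carrier \<A>" "z \<in> carrier \<A>"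
  then show "(x \<oplus>\<^bsub>\<A>\<^esub> y) \<otimes>\<^bsub>\<A>\<^esub> z = x \<otimes>\<^bsub>\<A>\<^esub> z \<oplus>\<^bsub>\<A>\<^esub> y \<otimes>\<^bsub>\<A>\<^esub> z"
    by (intro pairing_ext) (simp_all add: add_closed mult_closed pairing_mult)
qed (rule add_mult_right)

lemma assoc_algebra: "assoc_algebra K \<A>"
proof (intro assoc_algebra.intro assoc_algebra_axioms.intro moduleI)
  show "cring K" by (rule K.is_cring)
  show "abelian_group \<A>" by (rule abelian_group)
  show "ring \<A>" by (rule ring)
  show "a \<otimes>\<^bsub>\<A>\<^esub> (c \<odot>\<^bsub>\<A>\<^esub> b) = c \<odot>\<^bsub>\<A>\<^esub> (a \<otimes>\<^bsub>\<A>\<^esub> b)"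
    if "c \<in> carrier K" "a \<in> carrier \<A>" "b \<in> carrier \<A>" for a b c
    using that by (intro mult_smult)
qed (auto intro!: pairing_ext simp: smult_closed add_closed mult_closed pairing_mult
    l_distr r_distr m_assoc)

lemma pairing_finsum:
  assumes a: "a \<in> carrier \<A>" and "finite S" "\<And>k. k \<in> S \<Longrightarrow> \<phi> k \<in> carrier M \<rightarrow> carrier K"
  shows "pairing (\<lambda>m. \<Oplus>k\<in>S. \<phi> k m) a = (\<Oplus>k\<in>S. pairing (\<phi> k) a)"
  using assms(2,3)
proof (induction S)
  case empty
  then show ?case using a mem_closed[OF a]
    by (auto simp: pairing_def supp_def intro!: add.finprod_one_eqI)
next
  case (insert k S)
  have "pairing (\<lambda>m. \<Oplus>k\<in>insert k S. \<phi> k m) a = pairing (\<lambda>m. \<phi> k m \<oplus> (\<Oplus>k\<in>S. \<phi> k m)) a"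
    using insert a by (intro pairing_cong) (auto simp: Pi_iff intro!: add.finprod_closed)
  also have "\<dots> = pairing (\<phi> k) a \<oplus> (\<Oplus>k\<in>S. pairing (\<phi> k) a)"
    using insert a by (subst pairing_fun_add) (auto simp: Pi_iff intro!: add.finprod_closed)
  also have "\<dots> = (\<Oplus>k\<in>insert k S. pairing (\<phi> k) a)"
    using insert a by (subst add.finprod_insert) auto
  finally show ?case .
qed

section \<open>The augmentation and the zero of the monoid\<close>

lemma pairing_const:
  assumes "a \<in> carrier \<A>" "c \<in> carrier K"
  shows "pairing (\<lambda>_. c) a = c \<otimes> pairing (\<lambda>_. \<one>) a"
  using pairing_fun_smult[OF assms(1), of "\<lambda>_. \<one>" c] assms by simp

text \<open>For the constant function 1 the inner pairing in \<open>pairing_mult\<close> does not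
  depend on \<open>u\<close>, so the iterated pairing factors.\<close>

lemma pairing_one_hom: "pairing (\<lambda>_. \<one>) \<in> ring_hom \<A> K"
proof (rule ring_hom_memI)
  fix x y assume xy: "x \<in> carrier \<A>" "y \<in> carrier \<A>"
  then show "pairing (\<lambda>_. \<one>) (x \<otimes>\<^bsub>\<A>\<^esub> y) = pairing (\<lambda>_. \<one>) x \<otimes> pairing (\<lambda>_. \<one>) y"
    by (simp add: pairing_mult pairing_const[of x "pairing (\<lambda>_. \<one>) y"] m_comm)
qed (simp_all add: one_eq)

lemma mult_basis_zero:
  assumes x: "x \<in> carrier \<A>" and z: "is_monoid_zero M z"
  shows "x \<otimes>\<^bsub>\<A>\<^esub> basis_elt K M z = pairing (\<lambda>_. \<one>) x \<odot>\<^bsub>\<A>\<^esub> basis_elt K M z"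
    and "basis_elt K M z \<otimes>\<^bsub>\<A>\<^esub> x = pairing (\<lambda>_. \<one>) x \<odot>\<^bsub>\<A>\<^esub> basis_elt K M z"
proof -
  have zc: "z \<in> carrier M" using z by (simp add: is_monoid_zero_def)
  \<comment> \<open>One computation for both products: \<open>f\<close> is u \<mapsto> \<phi>(u z)
    or u \<mapsto> \<phi>(z u). Each is constant with value \<phi>(z), so pairing with it gives
    \<phi>(z) times the augmentation.\<close>
  have eq: "pairing f x = pairing \<phi> (pairing (\<lambda>_. \<one>) x \<odot>\<^bsub>\<A>\<^esub> basis_elt K M z)"
    if "\<phi> \<in> carrier M \<rightarrow> carrier K" "\<And>u. u \<in> carrier M \<Longrightarrow> f u = \<phi> z" for f \<phi>
  proof -
    have "pairing f x = pairing (\<lambda>u. \<phi> z) x"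
      using x that zc by (intro pairing_cong) (auto simp: Pi_iff)
    then show ?thesis
      using x that zc by (simp add: pairing_const[of x "\<phi> z"] Pi_iff m_comm)
  qed
  show "x \<otimes>\<^bsub>\<A>\<^esub> basis_elt K M z = pairing (\<lambda>_. \<one>) x \<odot>\<^bsub>\<A>\<^esub> basis_elt K M z"
    using x z zc by (intro pairing_ext)
      (auto simp: pairing_mult_basis_right mult_closed smult_closed is_monoid_zero_def
        simp del: pairing_smult intro!: eq)
  show "basis_elt K M z \<otimes>\<^bsub>\<A>\<^esub> x = pairing (\<lambda>_. \<one>) x \<odot>\<^bsub>\<A>\<^esub> basis_elt K M z"
    using x z zc by (intro pairing_ext)
      (auto simp: pairing_mult_basis_left mult_closed smult_closed is_monoid_zero_def
        simp del: pairing_smult intro!: eq)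
qed

end

section \<open>The center of the algebra of order-preserving partial functions\<close>

text \<open>A surjection of a finite set onto itself is a bijection, and an order-preserving
  bijection of a finite chain moves no point. The induction goes upwards from the least
  point.\<close>

lemma PO_self_map_eq_id:
  assumes h: "h \<in> carrier (PO n)" and ran: "ran h = dom h"
  shows "h = Some |` dom h"
proof -
  have fin: "finite (dom h)"
    using h finite_subset by (fastforce simp: PO_def)
  have img: "(\<lambda>x. the (h x)) ` dom h = dom h"
  proof -
    have "(\<lambda>x. the (h x)) ` dom h = ran h" by (force simp: ran_def)
    then show ?thesis by (simp only: ran)
  qed
  have inj: "inj_on (\<lambda>x. the (h x)) (dom h)"
    using fin img by (simp add: eq_card_imp_inj_on)
  have "x \<in> dom h \<longrightarrow> h x = Some x" for x
  proof (induction x rule: less_induct)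
    case (less x)
    show ?case
    proof
      assume x: "x \<in> dom h"
      then obtain u where u: "h x = Some u" by blast
      have ud: "u \<in> dom h" using u ran by (auto simp: ran_def)
      obtain z where z: "h z = Some x" using x ran by (auto simp: ran_def)
      consider "u < x" | "u = x" | "u > x" by linarith
      then show "h x = Some x"
      proof cases
        case 1
        \<comment> \<open>The smaller point \<open>u\<close> is already fixed, so \<open>x\<close>
          and \<open>u\<close> have the same image.\<close>
        then have "h u = Some u" using less ud by blast
        then show ?thesis using inj_onD[OF inj, of u x] u ud x by simp
      next
        case 2
        then show ?thesis using u by simp
      next
        case 3
        \<comment> \<open>A preimage of \<open>x\<close> below \<open>x\<close> would be fixed by
          induction, and \<open>x\<close> itself goes to \<open>u\<close>. Hence \<open>z\<close>
          lies above \<open>x\<close>, and monotonicity bounds \<open>u\<close> by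
          \<open>x\<close>.\<close>
        have "z > x" using less[of z] z u 3 by (cases z x rule: linorder_cases) auto
        then have "u \<le> x" using PO_memD(3)[OF h u z] by simp
        then show ?thesis using 3 by simp
      qed
    qed
  qed
  then show ?thesis by (auto simp: restrict_map_def fun_eq_iff domIff)
qed

lemma PO_id_on: "A \<subseteq> {1..n} \<Longrightarrow> Some |` A \<in> carrier (PO n)"
  by (rule PO_memI) (auto simp: restrict_map_def split: if_splits)

lemma map_le_iff: "f \<subseteq>\<^sub>m g \<longleftrightarrow> (\<forall>x y. f x = Some y \<longrightarrow> g x = Some y)"
  by (force simp: map_le_def)

lemma map_le_iff_restrict: "f \<subseteq>\<^sub>m g \<longleftrightarrow> g |` dom f = f"
  by (force simp: map_le_def restrict_map_def fun_eq_iff domIff)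

lemma restrict_Some_iff: "(Some |` A) x = Some y \<longleftrightarrow> x \<in> A \<and> y = x"
  by (auto simp: restrict_map_def)

lemma map_le_id_on_iff: "f \<subseteq>\<^sub>m Some |` A \<longleftrightarrow> f = Some |` dom f \<and> dom f \<subseteq> A"
proof
  assume f: "f \<subseteq>\<^sub>m Some |` A"
  then have "dom f \<subseteq> A" by (auto simp: map_le_iff restrict_Some_iff)
  then have "(Some |` A) |` dom f = Some |` dom f" by (simp add: Int_absorb1)
  then show "f = Some |` dom f \<and> dom f \<subseteq> A"
    using f \<open>dom f \<subseteq> A\<close> by (simp add: map_le_iff_restrict)
next
  assume f: "f = Some |` dom f \<and> dom f \<subseteq> A"
  then have "(Some |` A) |` dom f = Some |` dom f" by (simp add: Int_absorb1)
  then show "f \<subseteq>\<^sub>m Some |` A" using f by (simp add: map_le_iff_restrict)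
qed

lemma map_le_empty_iff: "f \<subseteq>\<^sub>m Map.empty \<longleftrightarrow> f = Map.empty"
  using map_le_implies_dom_le[of f Map.empty] by auto

text \<open>Composing with the identity on \<open>A\<close> on the right cuts down the domain, on
  the left the range. Commuting with partial identities compares these two effects.\<close>

lemma map_le_comp_id_right:
  "h \<subseteq>\<^sub>m g \<circ>\<^sub>m (Some |` A) \<longleftrightarrow> h \<subseteq>\<^sub>m g \<and> dom h \<subseteq> A"
  by (auto simp: map_le_iff map_comp_Some_iff restrict_Some_iff subset_iff)

lemma map_le_comp_id_left:
  "h \<subseteq>\<^sub>m (Some |` A) \<circ>\<^sub>m g \<longleftrightarrow> h \<subseteq>\<^sub>m g \<and> ran h \<subseteq> A"
  by (auto simp: map_le_iff map_comp_Some_iff restrict_Some_iff subset_iff ran_def)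

definition const_map :: "'a set \<Rightarrow> 'b \<Rightarrow> 'a \<rightharpoonup> 'b" where
  "const_map A a = (\<lambda>x. if x \<in> A then Some a else None)"

lemma PO_const_map: "A \<subseteq> {1..n} \<Longrightarrow> a \<in> {1..n} \<Longrightarrow> const_map A a \<in> carrier (PO n)"
  by (rule PO_memI) (auto simp: const_map_def split: if_splits)

lemma const_map_Some_iff: "const_map A a x = Some y \<longleftrightarrow> x \<in> A \<and> y = a"
  by (auto simp: const_map_def)

text \<open>This equivalence and the next one evaluate the two sides of \<open>central_ind\<close>
  at a constant map: \<open>g\<close> fixes \<open>a\<close> on one side, \<open>g\<close> maps
  \<open>A\<close> into itself on the other. A point of \<open>A\<close> is needed to test the value
  at \<open>a\<close>.\<close>

lemma const_map_le_comp_right: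
  assumes "A \<noteq> {}"
  shows "const_map A a \<subseteq>\<^sub>m g \<circ>\<^sub>m const_map A a \<longleftrightarrow> Some |` {a} \<subseteq>\<^sub>m g"
  using assms by (auto simp: map_le_iff map_comp_Some_iff const_map_Some_iff restrict_Some_iff)

lemma const_map_le_comp_left:
  "const_map A a \<subseteq>\<^sub>m const_map A a \<circ>\<^sub>m g \<longleftrightarrow> A \<subseteq> dom g \<and> ran (g |` A) \<subseteq> A"
proof -
  have "const_map A a \<subseteq>\<^sub>m const_map A a \<circ>\<^sub>m g \<longleftrightarrow> (\<forall>x\<in>A. \<exists>y\<in>A. g x = Some y)"
    by (auto simp: map_le_iff map_comp_Some_iff const_map_Some_iff)
  also have "\<dots> \<longleftrightarrow> A \<subseteq> dom g \<and> ran (g |` A) \<subseteq> A"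
    by (fastforce simp: ran_def restrict_map_def split: if_splits)
  finally show ?thesis .
qed

section \<open>Coordinates by sums over extensions\<close>

locale PO_algebra = field K for K :: "('k, 'x) ring_scheme" (structure) + fixes n :: nat
begin

sublocale monoid_algebra_setting K "PO n"
  by (intro monoid_algebra_setting.intro is_cring monoid_PO)

definition ind :: "((nat \<rightharpoonup> nat) \<Rightarrow> bool) \<Rightarrow> (nat \<rightharpoonup> nat) \<Rightarrow> 'k" where
  "ind P g = (if P g then \<one> else \<zero>)"

lemma ind_fun [simp]: "ind P \<in> S \<rightarrow> carrier K"
  by (auto simp: ind_def)

lemma ind_False: "pairing (ind (\<lambda>_. False)) x = \<zero>" if "x \<in> carrier \<A>"
  using that mem_closed[OF that]
  by (auto simp: pairing_def ind_def supp_def intro!: add.finprod_one_eqI)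

text \<open>The zeta transform of the coefficients for the extension order. Written as a pairing, it
  inherits linearity and the product formula.\<close>

definition hat :: "(nat \<rightharpoonup> nat) \<Rightarrow> ((nat \<rightharpoonup> nat) \<Rightarrow> 'k) \<Rightarrow> 'k" where
  "hat f = pairing (ind (\<lambda>g. f \<subseteq>\<^sub>m g))"

lemma hat_closed [simp]: "x \<in> carrier \<A> \<Longrightarrow> hat f x \<in> carrier K"
  by (simp add: hat_def)

text \<open>The transform is unitriangular. An element \<open>f\<close> of the support with the
  largest domain has no other extension in the support, so \<open>hat f x\<close> is the nonzero
  coefficient at \<open>f\<close>. No explicit Moebius inversion is required.\<close>

lemma hat_all_zero:
  assumes x: "x \<in> carrier \<A>" and zero: "\<And>f. f \<in> carrier (PO n) \<Longrightarrow> hat f x = \<zero>"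
  shows "x = \<zero>\<^bsub>\<A>\<^esub>"
proof -
  let ?S = "supp K (PO n) x"
  have "?S = {}"
  proof (rule ccontr)
    assume ne: "?S \<noteq> {}"
    let ?C = "(\<lambda>g. card (dom g)) ` ?S"
    have C: "finite ?C" "?C \<noteq> {}" using ne finite_supp[OF x] by auto
    obtain f where f: "f \<in> ?S" "card (dom f) = Max ?C" using Max_in[OF C] by auto
    have max: "card (dom g) \<le> card (dom f)" if "g \<in> ?S" for g
      using that f(2) Max_ge[OF C(1)] by simp
    have fin: "finite (dom g)" if "g \<in> ?S" for g
      using that finite_subset by (fastforce simp: PO_def supp_def)
    have eq: "g = f" if "g \<in> ?S" "f \<subseteq>\<^sub>m g" for g
    proof -
      have "dom f = dom g"
        using that max[OF that(1)] fin[OF that(1)] map_le_implies_dom_le[OF that(2)] by (intro card_seteq) auto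
      moreover have "g |` dom g = g" by (simp flip: map_le_iff_restrict)
      ultimately show "g = f" using that(2) by (simp add: map_le_iff_restrict)
    qed
    have xf: "x f \<in> carrier K" "x f \<noteq> \<zero>" using f(1) x by (auto simp: supp_def mem_closed)
    have "hat f x = (\<Oplus>g\<in>?S. if f = g then x g else \<zero>)"
      unfolding hat_def pairing_def
      using mem_closed[OF x] eq by (intro add.finprod_cong') (auto simp: ind_def supp_def)
    also have "\<dots> = x f"
      using f(1) finite_supp[OF x] mem_closed[OF x] by (intro add.finprod_singleton) (auto simp: supp_def)
    finally show False using xf zero[of f] f(1) by (simp add: supp_def)
  qed
  then have "pairing \<phi> x = \<zero>" for \<phi> by (simp add: pairing_def)
  then show ?thesis
    using x by (intro pairing_ext) (simp_all add: zero_closed)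
qed

lemma hat_ext:
  assumes "x \<in> carrier \<A>" "y \<in> carrier \<A>"
    and "\<And>f. f \<in> carrier (PO n) \<Longrightarrow> hat f x = hat f y"
  shows "x = y"
proof (rule pairing_ext)
  \<comment> \<open>The difference is spelled with the scalar -1 so that \<open>pairing_add\<close>
    and \<open>pairing_smult\<close> apply.\<close>
  let ?d = "x \<oplus>\<^bsub>\<A>\<^esub> (\<ominus> \<one>) \<odot>\<^bsub>\<A>\<^esub> y"
  have p: "pairing \<phi> ?d = pairing \<phi> x \<ominus> pairing \<phi> y" if "\<phi> \<in> carrier (PO n) \<rightarrow> carrier K" for \<phi>
    using that assms(1,2) by (simp add: smult_closed l_minus a_minus_def)
  have "hat f ?d = \<zero>" if "f \<in> carrier (PO n)" for f
    using assms that unfolding hat_def p[OF ind_fun] by simp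
  then have "?d = \<zero>\<^bsub>\<A>\<^esub>"
    using assms by (intro hat_all_zero) (simp_all add: add_closed smult_closed)
  then show "pairing \<phi> x = pairing \<phi> y" if "\<phi> \<in> carrier (PO n) \<rightarrow> carrier K" for \<phi>
    using p[OF that] that assms(1,2) by (metis pairing_zero pairing_closed r_right_minus_eq)
qed (use assms in auto)

lemma hat_basis:
  "f \<in> carrier (PO n) \<Longrightarrow> g \<in> carrier (PO n) \<Longrightarrow> hat f (basis_elt K (PO n) g) = (if f \<subseteq>\<^sub>m g then \<one> else \<zero>)"
  by (simp add: hat_def ind_def)

section \<open>Central elements in these coordinates\<close>

context
  fixes x
  assumes x: "x \<in> carrier \<A>"
    and central: "\<And>y. y \<in> carrier \<A> \<Longrightarrow> x \<otimes>\<^bsub>\<A>\<^esub> y = y \<otimes>\<^bsub>\<A>\<^esub> x"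
begin

text \<open>Commutation with the basis element of \<open>s\<close>, tested by the functional that
  sums the coefficients on \<open>P\<close>.\<close>

lemma central_ind:
  assumes s: "s \<in> carrier (PO n)"
  shows "pairing (ind (\<lambda>g. P (g \<circ>\<^sub>m s))) x = pairing (ind (\<lambda>g. P (s \<circ>\<^sub>m g))) x"
proof -
  have "pairing (ind P) (x \<otimes>\<^bsub>\<A>\<^esub> basis_elt K (PO n) s) = pairing (ind P) (basis_elt K (PO n) s \<otimes>\<^bsub>\<A>\<^esub> x)"
    by (simp add: central)
  then show ?thesis
    using x s by (simp add: pairing_mult_basis_left pairing_mult_basis_right PO_mult ind_def[abs_def])
qed

text \<open>Commuting with the identity on \<open>A\<close> equates \<open>hat h x\<close>, kept
  only if \<open>A\<close> contains the domain of \<open>h\<close>, with \<open>hat h x\<close>,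
  kept only if \<open>A\<close> contains the range. A nonzero value forces domain and range to
  agree, and then \<open>h\<close> is a partial identity.\<close>

lemma central_hat_nonid:
  assumes h: "h \<in> carrier (PO n)" and ne: "h \<noteq> Some |` dom h"
  shows "hat h x = \<zero>"
proof (rule ccontr)
  assume nz: "hat h x \<noteq> \<zero>"
  have *: "dom h \<subseteq> A \<longleftrightarrow> ran h \<subseteq> A" if A: "A \<subseteq> {1..n}" for A
    using central_ind[OF PO_id_on[OF A], of "\<lambda>g. h \<subseteq>\<^sub>m g"] nz x ind_False[OF x]
    by (cases "dom h \<subseteq> A"; cases "ran h \<subseteq> A")
      (simp_all add: map_le_comp_id_left map_le_comp_id_right hat_def)
  have "dom h \<subseteq> {1..n}" "ran h \<subseteq> {1..n}" using h by (simp_all add: PO_def)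
  \<comment> \<open>Testing with \<open>A\<close> equal to the domain and to the range gives the two
    inclusions.\<close>
  then have "ran h = dom h" using *[of "dom h"] *[of "ran h"] by auto
  then show False using PO_self_map_eq_id[OF h] ne by simp
qed

text \<open>Commuting with the constant map from \<open>A\<close> to \<open>a\<close> equates the
  value at the identity on {a} with the sum of the coefficients at all \<open>g\<close> that map
  \<open>A\<close> into itself. That sum splits by the restriction of \<open>g\<close> to
  \<open>A\<close>, and only the identity on \<open>A\<close> contributes.\<close>

lemma central_hat_id:
  assumes A: "A \<subseteq> {1..n}" "A \<noteq> {}" and a: "a \<in> {1..n}"
  shows "hat (Some |` A) x = hat (Some |` {a}) x"
proof -
  \<comment> \<open>The possible restrictions to \<open>A\<close>: order-preserving maps from all of
    \<open>A\<close> into \<open>A\<close>.\<close>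
  define S where "S = {k \<in> carrier (PO n). dom k = A \<and> ran k \<subseteq> A}"
  have finA: "finite A" using A finite_subset by blast
  have fin: "finite S"
    by (rule finite_subset[OF _ finite_set_of_finite_maps[OF finA finA]]) (auto simp: S_def)
  have idS: "Some |` A \<in> S" using PO_id_on[OF A(1)] by (auto simp: S_def ran_def restrict_map_def split: if_splits)
  \<comment> \<open>If \<open>g\<close> maps \<open>A\<close> into itself, it extends exactly one
    member of \<open>S\<close>, its restriction to \<open>A\<close>; otherwise it extends
    none.\<close>
  have sum: "ind (\<lambda>g. A \<subseteq> dom g \<and> ran (g |` A) \<subseteq> A) g = (\<Oplus>k\<in>S. ind (\<lambda>g. k \<subseteq>\<^sub>m g) g)"
    if g: "g \<in> carrier (PO n)" for g
  proof (cases "A \<subseteq> dom g \<and> ran (g |` A) \<subseteq> A")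
    case True
    have "g |` A \<in> carrier (PO n)"
      using PO_memD[OF g] by (intro PO_memI) (auto simp: restrict_map_def split: if_splits)
    then have gS: "g |` A \<in> S" using True by (auto simp: S_def)
    have "k \<subseteq>\<^sub>m g \<longleftrightarrow> g |` A = k" if "k \<in> S" for k
      using that by (auto simp: map_le_iff_restrict S_def)
    then have "(\<Oplus>k\<in>S. ind (\<lambda>g. k \<subseteq>\<^sub>m g) g) = (\<Oplus>k\<in>S. if g |` A = k then \<one> else \<zero>)"
      by (intro add.finprod_cong') (auto simp: ind_def)
    also have "\<dots> = \<one>" using gS fin by (intro add.finprod_singleton) auto
    finally show ?thesis using True by (simp add: ind_def)
  next
    case False
    have "\<not> k \<subseteq>\<^sub>m g" if "k \<in> S" for k
    proof
      assume "k \<subseteq>\<^sub>m g"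
      then have "g |` A = k" "A \<subseteq> dom g"
        using that map_le_implies_dom_le[of k g] by (auto simp: map_le_iff_restrict S_def)
      then show False using False that by (auto simp: S_def)
    qed
    then have "(\<Oplus>k\<in>S. ind (\<lambda>g. k \<subseteq>\<^sub>m g) g) = \<zero>"
      by (intro add.finprod_one_eqI) (auto simp: ind_def)
    then show ?thesis using False by (auto simp: ind_def)
  qed
  have "hat (Some |` {a}) x = pairing (ind (\<lambda>g. A \<subseteq> dom g \<and> ran (g |` A) \<subseteq> A)) x"
    using central_ind[OF PO_const_map[OF A(1) a], of "\<lambda>g. const_map A a \<subseteq>\<^sub>m g"] A(2)
    by (simp add: const_map_le_comp_left const_map_le_comp_right hat_def)
  also have "\<dots> = pairing (\<lambda>g. \<Oplus>k\<in>S. ind (\<lambda>g. k \<subseteq>\<^sub>m g) g) x"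
    using x sum by (intro pairing_cong) (auto simp: ind_def intro!: add.finprod_closed)
  also have "\<dots> = (\<Oplus>k\<in>S. hat k x)"
    unfolding hat_def using x fin by (intro pairing_finsum) auto
  \<comment> \<open>By \<open>central_hat_nonid\<close> a nonzero term requires \<open>k\<close> to
    be a partial identity, and its domain is \<open>A\<close>.\<close>
  also have "\<dots> = (\<Oplus>k\<in>S. if Some |` A = k then hat k x else \<zero>)"
    using x central_hat_nonid by (intro add.finprod_cong') (auto simp: S_def)
  also have "\<dots> = hat (Some |` A) x"
    using idS fin x by (intro add.finprod_singleton) auto
  finally show ?thesis ..
qed

text \<open>The transform of 1 is the indicator of the partial identities, that of the empty
  function \<open>z\<close> the indicator of \<open>z\<close> alone. So \<open>c\<close> is the
  common value at nonempty partial identities, and \<open>d\<close> corrects the value at the empty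
  one.\<close>

lemma central_eq:
  assumes n: "n \<ge> 1"
  shows "\<exists>c\<in>carrier K. \<exists>d\<in>carrier K.
    x = c \<odot>\<^bsub>\<A>\<^esub> \<one>\<^bsub>\<A>\<^esub> \<oplus>\<^bsub>\<A>\<^esub> d \<odot>\<^bsub>\<A>\<^esub> basis_elt K (PO n) Map.empty"
proof -
  define c where "c = hat \<one>\<^bsub>PO n\<^esub> x"
  define d where "d = hat Map.empty x \<ominus> c"
  have cd [simp]: "c \<in> carrier K" "d \<in> carrier K" using x by (simp_all add: c_def d_def)
  \<comment> \<open>Both the identity on \<open>A\<close> and the full identity are compared with
    the identity on {1}, which exists because \<open>n \<ge> 1\<close>.\<close>
  have id: "hat (Some |` A) x = c" if A: "A \<subseteq> {1..n}" "A \<noteq> {}" for A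
    using central_hat_id[OF A, of 1] central_hat_id[of "{1..n}" 1] n by (simp add: c_def PO_one)
  have empty: "Map.empty \<in> carrier (PO n)" by (rule PO_memI) simp_all
  let ?y = "c \<odot>\<^bsub>\<A>\<^esub> \<one>\<^bsub>\<A>\<^esub> \<oplus>\<^bsub>\<A>\<^esub> d \<odot>\<^bsub>\<A>\<^esub> basis_elt K (PO n) Map.empty"
  have y: "hat f ?y = c \<otimes> (if f \<subseteq>\<^sub>m \<one>\<^bsub>PO n\<^esub> then \<one> else \<zero>) \<oplus> d \<otimes> (if f \<subseteq>\<^sub>m Map.empty then \<one> else \<zero>)"
    if f: "f \<in> carrier (PO n)" for f
    using f empty hat_basis[OF f] by (simp add: hat_def one_eq smult_closed)
  have "x = ?y"
  proof (rule hat_ext[OF x])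
    show "?y \<in> carrier \<A>" by (simp add: add_closed smult_closed one_closed)
    fix f assume f: "f \<in> carrier (PO n)"
    then have dom: "dom f \<subseteq> {1..n}" by (simp add: PO_def)
    consider "f = Map.empty" | "f \<noteq> Map.empty" "f = Some |` dom f" | "f \<noteq> Some |` dom f" by blast
    then show "hat f x = hat f ?y"
    proof cases
      case 1
      have "c \<oplus> d = hat Map.empty x"
        using x by (simp only: d_def a_minus_def) (subst a_lcomm; simp add: r_neg)
      then show ?thesis unfolding y[OF f] using 1 by (simp add: d_def[symmetric])
    next
      case 2
      have "f \<subseteq>\<^sub>m \<one>\<^bsub>PO n\<^esub>" "\<not> f \<subseteq>\<^sub>m Map.empty"
        using 2 dom by (simp_all add: PO_one map_le_id_on_iff map_le_empty_iff)
      moreover have "hat f x = c" using id[OF dom] 2 by simp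
      ultimately show ?thesis unfolding y[OF f] by simp
    next
      case 3
      then have "\<not> f \<subseteq>\<^sub>m \<one>\<^bsub>PO n\<^esub>" "\<not> f \<subseteq>\<^sub>m Map.empty"
        by (auto simp: PO_one map_le_id_on_iff map_le_empty_iff)
      then show ?thesis unfolding y[OF f] using central_hat_nonid[OF f 3] by simp
    qed
  qed
  then show ?thesis using cd by blast
qed

end

end

section \<open>Assembly of the decomposition\<close>

theorem lemma4p6:
  fixes K :: "('k, 'x) ring_scheme" and n :: nat
  assumes "field K" and "n \<ge> 1"
  shows "isomorphic_algebras K (monoid_algebra K (PO n))
           (algebra_prod (self_algebra K) (contracted_monoid_algebra K (PO n)))
       \<and> connected_algebra K (self_algebra K)
       \<and> connected_algebra K (contracted_monoid_algebra K (PO n))"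
proof -
  interpret PO_algebra K n by (rule PO_algebra.intro[OF assms(1)])
  have zero: "is_monoid_zero (PO n) Map.empty"
    by (auto simp: is_monoid_zero_def PO_mult map_comp_def intro: PO_memI split: option.split)
  then have z: "Map.empty \<in> carrier (PO n)" by (simp add: is_monoid_zero_def)
  interpret aug: augmented_algebra K \<A> "pairing (\<lambda>_. \<one>\<^bsub>K\<^esub>)" "basis_elt K (PO n) Map.empty"
    by (intro augmented_algebra.intro augmented_algebra_axioms.intro assoc_algebra pairing_one_hom
        mult_basis_zero zero) (simp_all add: z)
  have quot: "contracted_monoid_algebra K (PO n) = algebra_quot \<A> aug.line"
    by (simp add: contracted_monoid_algebra_def aug.line_def monoid_zero_PO)
  have "connected_algebra K (algebra_quot \<A> aug.line)"
  proof (rule aug.connected_quot[OF assms(1)])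
    show "\<one>\<^bsub>\<A>\<^esub> \<notin> aug.line"
    proof
      assume "\<one>\<^bsub>\<A>\<^esub> \<in> aug.line"
      then obtain c where c: "c \<in> carrier K" "\<one>\<^bsub>\<A>\<^esub> = c \<odot>\<^bsub>\<A>\<^esub> basis_elt K (PO n) Map.empty"
        by (auto simp: aug.line_def)
      \<comment> \<open>As \<open>n \<ge> 1\<close>, the identity is not the empty function. So the
        coordinate at the identity is 1 on the one of the algebra but 0 on every multiple of the
        empty function.\<close>
      have "\<one>\<^bsub>PO n\<^esub> 1 = Some 1" using assms(2) by (simp add: PO_one)
      then have "\<one>\<^bsub>PO n\<^esub> \<noteq> Map.empty" by auto
      then have "hat \<one>\<^bsub>PO n\<^esub> (c \<odot>\<^bsub>\<A>\<^esub> basis_elt K (PO n) Map.empty) = \<zero>\<^bsub>K\<^esub>"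
        using c(1) z by (simp add: hat_def ind_def map_le_empty_iff)
      moreover have "hat \<one>\<^bsub>PO n\<^esub> \<one>\<^bsub>\<A>\<^esub> = \<one>\<^bsub>K\<^esub>" by (simp add: one_eq hat_basis)
      ultimately show False using c(2) one_not_zero by simp
    qed
  qed (rule central_eq[OF _ _ assms(2)])
  then show ?thesis
    using aug.splitting connected_self by (auto simp: isomorphic_algebras_def quot)
qed

end
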